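(* Among two-server PIR schemes with $N$ files satisfying the UDIQ condition and having uniform query distributions, the two-server PIR scheme obtained from the Maddah-Ali–Niesen (MAN) coded caching scheme, whose total download cost $R_D=R_{D_1}+R_{D_2}$ is $O(\sqrt N)$, is order optimal in total download cost: its total download cost is within a constant multiplicative factor, independent of $N$, of the minimum total download cost over all two-server PIR schemes with $N$ files satisfying the UDIQ condition and having uniform query distributions.
   Context: **Two-server PIR.** Each of two non-colluding servers stores $N$ independent files $W_1,\dots,W_N$ of $B$ bits. A user with demand $d\in\{1,\dots,N\}$ sends a query $Q_s^{[d]}\in\mathcal Q_s$ to server $s\in\{1,2\}$, which returns $A_s^{[d]}=\gamma_s(Q_s^{[d]},W_1,\dots,W_N)$. Requirements: $H(W_d\mid A_1^{[d]},A_2^{[d]},Q_1^{[d]},Q_2^{[d]})=0$ and, for $s=1,2$, $I(d;Q_s^{[d]}\mid W_1,\dots,W_N)=0$. By privacy $H(A_s^{[d]})=:H(A_s)$ does not depend on $d$; the download cost from server $s$ is $R_{D_s}=H(A_s)/B$, metadata being negligible with respect to the file size; the total download cost is $R_D=R_{D_1}+R_{D_2}$. **UDIQ (uniform demand and independent queries) condition.** The demand $d$ is uniformly distributed on $\{1,\dots,N\}$ and, with $d$ random, the two queries are independent: $I(Q_1^{[d]};Q_2^{[d]}\mid W_1,\dots,W_N)=0$. **Uniform query distribution.** The query sets are finite and $\Pr(Q_s=q)=1/|\mathcal Q_s|$ for every $q\in\mathcal Q_s$, $s=1,2$. **The scheme.** Let $t\in\{1,\dots,N\}$ be of order $\sqrt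 N$ (e.g. $t=\lfloor\sqrt N\rfloor$). Split each file into $\binom Nt$ equal subfiles $W_{n,\mathcal T}$, $\mathcal T\subseteq\{1,\dots,N\}$, $|\mathcal T|=t$. For $i\in\{1,\dots,N\}$ let $Z_i=\{W_{n,\mathcal T}: n\in\{1,\dots,N\},\ i\in\mathcal T\}$, and for a demand vector $\mathbf d=(d_1,\dots,d_N)$ let $X_{\mathbf d}$ be the collection of $\bigoplus_{i\in\mathcal S}W_{d_i,\mathcal S\setminus\{i\}}$ over all $\mathcal S\subseteq\{1,\dots,N\}$ with $|\mathcal S|=t+1$. With residues modulo $N$ taken in $\{1,\dots,N\}$, a user with (uniform) demand $\theta$ draws $r$ uniform on $\{1,\dots,N\}$ independently of $\theta$, sends $r$ to server 1, which answers $Z_r$, and sends $r-\theta \bmod N$ to server 2, which answers $X_{\mathbf d}$, where $d_i= i-(r-\theta)\bmod N$. Its download costs are $(R_{D_1},R_{D_2})=(t,\frac{N-t}{t+1})$. *)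

theory Defs
  imports "HOL-Probability.Probability"
begin

text \<open>Information measures in bits. The base space is the support of the law, so that
  random variables with finitely many values there are simple functions and the finite-alphabet
  theory of \<^locale>\<open>information_space\<close> applies; the constants are the library's
  \<open>entropy_Pow\<close>, \<open>conditional_entropy_Pow\<close> and \<open>conditional_mutual_information_Pow\<close>.\<close>

definition support_space :: "'a pmf \<Rightarrow> 'a measure" where
  "support_space p = point_measure (set_pmf p) (\<lambda>x. ennreal (pmf p x))"

definition Ent :: "'a pmf \<Rightarrow> ('a \<Rightarrow> 'b) \<Rightarrow> real" where
  "Ent p X = prob_space.entropy (support_space p) 2 (count_space (X ` set_pmf p)) X"

definition CondEnt :: "'a pmf \<Rightarrow> ('a \<Rightarrow> 'b) \<Rightarrow> ('a \<Rightarrow> 'c) \<Rightarrow> real" where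
  "CondEnt p X Y = prob_space.conditional_entropy (support_space p) 2
     (count_space (X ` set_pmf p)) (count_space (Y ` set_pmf p)) X Y"

definition CondMutInf :: "'a pmf \<Rightarrow> ('a \<Rightarrow> 'b) \<Rightarrow> ('a \<Rightarrow> 'c) \<Rightarrow> ('a \<Rightarrow> 'd) \<Rightarrow> real" where
  "CondMutInf p X Y Z = prob_space.conditional_mutual_information (support_space p) 2
     (count_space (X ` set_pmf p)) (count_space (Y ` set_pmf p)) (count_space (Z ` set_pmf p)) X Y Z"

section \<open>Two-server private information retrieval\<close>

type_synonym files = "nat \<Rightarrow> bool list"

text \<open>Query alphabets are sets of natural numbers and answers are bit strings. As all alphabets are
  finite and all requirements and costs are invariant under injective relabelling of queries and
  answers, this covers arbitrary finite alphabets. \<open>query_law P d\<close> is the joint law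
  of the two queries for demand \<open>d\<close>.\<close>

record pir =
  file_bits :: nat
  demand_law :: "nat pmf"
  queries1 :: "nat set"
  queries2 :: "nat set"
  query_law :: "nat \<Rightarrow> (nat \<times> nat) pmf"
  answer1 :: "nat \<Rightarrow> files \<Rightarrow> bool list"
  answer2 :: "nat \<Rightarrow> files \<Rightarrow> bool list"

definition file_space :: "nat \<Rightarrow> nat \<Rightarrow> files set" where
  "file_space N B = (\<Pi>\<^sub>E n\<in>{1..N}. {w. length w = B})"

record outcome =
  W :: files
  demand :: nat
  Q1 :: nat
  Q2 :: nat

text \<open>The joint law of files, demand and queries when the demand has law \<open>D\<close>: the files are
  independent, uniform, and independent of the user's choices. The law of the variables with
  superscript \<open>[k]\<close> is obtained for \<open>D = return_pmf k\<close>.\<close>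

definition joint_law :: "nat \<Rightarrow> pir \<Rightarrow> nat pmf \<Rightarrow> outcome pmf" where
  "joint_law N P D = do {
     w \<leftarrow> pmf_of_set (file_space N (file_bits P));
     k \<leftarrow> D;
     (q1, q2) \<leftarrow> query_law P k;
     return_pmf \<lparr>W = w, demand = k, Q1 = q1, Q2 = q2\<rparr> }"

abbreviation law :: "nat \<Rightarrow> pir \<Rightarrow> outcome pmf" where
  "law N P \<equiv> joint_law N P (demand_law P)"

definition A1 :: "pir \<Rightarrow> outcome \<Rightarrow> bool list" where
  "A1 P \<omega> = answer1 P (Q1 \<omega>) (W \<omega>)"

definition A2 :: "pir \<Rightarrow> outcome \<Rightarrow> bool list" where
  "A2 P \<omega> = answer2 P (Q2 \<omega>) (W \<omega>)"

definition well_formed :: "nat \<Rightarrow> pir \<Rightarrow> bool" where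
  "well_formed N P \<longleftrightarrow> file_bits P > 0 \<and> set_pmf (demand_law P) \<subseteq> {1..N} \<and>
     (\<forall>k\<in>{1..N}. set_pmf (query_law P k) \<subseteq> queries1 P \<times> queries2 P)"

definition decodable :: "nat \<Rightarrow> pir \<Rightarrow> bool" where
  "decodable N P \<longleftrightarrow> (\<forall>k\<in>{1..N}.
     CondEnt (joint_law N P (return_pmf k)) (\<lambda>\<omega>. W \<omega> k)
       (\<lambda>\<omega>. (A1 P \<omega>, A2 P \<omega>, Q1 \<omega>, Q2 \<omega>)) = 0)"

definition user_private :: "nat \<Rightarrow> pir \<Rightarrow> bool" where
  "user_private N P \<longleftrightarrow> CondMutInf (law N P) demand Q1 W = 0 \<and> CondMutInf (law N P) demand Q2 W = 0"

definition two_server_PIR :: "nat \<Rightarrow> pir \<Rightarrow> bool" where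
  "two_server_PIR N P \<longleftrightarrow> well_formed N P \<and> decodable N P \<and> user_private N P"

definition UDIQ :: "nat \<Rightarrow> pir \<Rightarrow> bool" where
  "UDIQ N P \<longleftrightarrow> demand_law P = pmf_of_set {1..N} \<and> CondMutInf (law N P) Q1 Q2 W = 0"

definition uniform_queries :: "nat \<Rightarrow> pir \<Rightarrow> bool" where
  "uniform_queries N P \<longleftrightarrow> finite (queries1 P) \<and> finite (queries2 P) \<and>
     (\<forall>q\<in>queries1 P. measure_pmf.prob (law N P) {\<omega>. Q1 \<omega> = q} = 1 / real (card (queries1 P))) \<and>
     (\<forall>q\<in>queries2 P. measure_pmf.prob (law N P) {\<omega>. Q2 \<omega> = q} = 1 / real (card (queries2 P)))"

text \<open>Download costs are evaluated with the demand random; for a private scheme the law of each answer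
  is the same for every demand, hence equal to its law under \<open>joint_law N P (return_pmf k)\<close>
  for each \<open>k\<close>.\<close>

definition download_cost1 :: "nat \<Rightarrow> pir \<Rightarrow> real" where
  "download_cost1 N P = Ent (law N P) (A1 P) / real (file_bits P)"

definition download_cost2 :: "nat \<Rightarrow> pir \<Rightarrow> real" where
  "download_cost2 N P = Ent (law N P) (A2 P) / real (file_bits P)"

definition total_download_cost :: "nat \<Rightarrow> pir \<Rightarrow> real" where
  "total_download_cost N P = download_cost1 N P + download_cost2 N P"

section \<open>The scheme obtained from Maddah-Ali--Niesen coded caching\<close>

definition subsets_of_size :: "nat \<Rightarrow> nat \<Rightarrow> nat set list" where
  "subsets_of_size N t = filter (\<lambda>T. card T = t) (map set (List.subseqs [1..<Suc N]))"

text \<open>A file of \<open>L * (N choose t)\<close> bits is cut into consecutive blocks of \<open>L\<close> bits, one for each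
  \<open>t\<close>-subset, in the order of \<^const>\<open>subsets_of_size\<close>.\<close>

definition subfile :: "nat \<Rightarrow> nat \<Rightarrow> nat \<Rightarrow> bool list \<Rightarrow> nat set \<Rightarrow> bool list" where
  "subfile N t L w T =
     (let j = length (takeWhile (\<lambda>T'. T' \<noteq> T) (subsets_of_size N t)) in take L (drop (j * L) w))"

definition xor_list :: "nat \<Rightarrow> bool list list \<Rightarrow> bool list" where
  "xor_list L xs = foldr (map2 (\<noteq>)) xs (replicate L False)"

text \<open>Both collections are sent as the concatenation of their members in a fixed order, without labels.\<close>

definition man_cache :: "nat \<Rightarrow> nat \<Rightarrow> nat \<Rightarrow> nat \<Rightarrow> files \<Rightarrow> bool list" where
  "man_cache N t L i w =
     concat [subfile N t L (w n) T. n \<leftarrow> [1..<Suc N], T \<leftarrow> subsets_of_size N t, i \<in> T]"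

definition man_delivery :: "nat \<Rightarrow> nat \<Rightarrow> nat \<Rightarrow> (nat \<Rightarrow> nat) \<Rightarrow> files \<Rightarrow> bool list" where
  "man_delivery N t L dem w =
     concat [xor_list L [subfile N t L (w (dem i)) (S - {i}). i \<leftarrow> [1..<Suc N], i \<in> S].
       S \<leftarrow> subsets_of_size N (Suc t)]"

text \<open>Residues modulo \<open>N\<close> in \<open>{1..N}\<close>.\<close>

definition residue :: "nat \<Rightarrow> int \<Rightarrow> nat" where
  "residue N x = nat ((x - 1) mod int N) + 1"

definition man_pir :: "nat \<Rightarrow> nat \<Rightarrow> nat \<Rightarrow> pir" where
  "man_pir N t L =
     \<lparr>file_bits = L * (N choose t),
      demand_law = pmf_of_set {1..N},
      queries1 = {1..N},
      queries2 = {1..N},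
      query_law = (\<lambda>\<theta>. map_pmf (\<lambda>r. (r, residue N (int r - int \<theta>))) (pmf_of_set {1..N})),
      answer1 = (\<lambda>r. man_cache N t L r),
      answer2 = (\<lambda>q. man_delivery N t L (\<lambda>i. residue N (int i - int q)))\<rparr>"

end

theory Submission
  imports Defs
begin

text \<open>Lower bound: send \<open>s \<approx> \<surd>N\<close> independent queries to each server. By privacy and the UDIQ
  condition, the demands attached to the \<open>s\<^sup>2\<close> query pairs are pairwise independent and uniform, so a
  constant fraction of the files can be decoded from these \<open>2 s\<close> answers on average. Hence
  \<open>s (R\<^sub>D\<^sub>1 + R\<^sub>D\<^sub>2) \<ge> s\<^sup>2 / 2\<close>, whereas the Maddah-Ali--Niesen scheme costs
  \<open>t + (N - t) / (t + 1)\<close>, of order \<open>\<surd>N\<close>.\<close>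

section \<open>Information measures of finitely supported laws\<close>

text \<open>Two obstacles shape the argument. A query pair need not determine the demand, and grid
  cells share rows and columns, so their demands are in general not jointly independent. The demand
  is therefore replaced by its conditional law given the query pair: any demand of positive
  probability at a cell is decodable from that cell. Privacy controls cells in one row or column:
  with the shared query fixed, averaging over the query to the other server leaves a uniform demand.
  Only pairs of cells are controlled, hence a second moment argument, at the price of the factor
  1/2. On the entropy side, answers to fixed queries are functions of the files alone, whereas the
  cost is the entropy of an answer under random queries. Measuring each answer against its marginal
  law gives a cross-entropy bound that is valid for every fixed grid and whose average over the
  queries is exactly that entropy. The requirements are vanishing information quantities, so they
  are used as exact statements: a function exists, or a joint law is a product.\<close>

lemma sum_image_pmf:
  fixes g :: "'b \<Rightarrow> real"
  assumes "finite (set_pmf p)"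
  shows "(\<Sum>x\<in>X ` set_pmf p. pmf (map_pmf X p) x * g x) = measure_pmf.expectation p (\<lambda>\<omega>. g (X \<omega>))"
proof -
  have "measure_pmf.expectation (map_pmf X p) g = (\<Sum>x\<in>X ` set_pmf p. g x * pmf (map_pmf X p) x)"
    using assms by (intro integral_measure_pmf_real) (auto simp: set_pmf_iff)
  then show ?thesis by (simp add: mult.commute)
qed

text \<open>On the finite support every set is measurable and carries its \<open>pmf\<close>
  probability, so every random variable is a simple function and the finite-alphabet formulas of
  \<open>information_space\<close> apply.\<close>

lemma
  assumes fin: "finite (set_pmf p)"
  shows space_support_space: "space (support_space p) = set_pmf p"
    and information_space_support_space: "information_space (support_space p) 2"
    and simple_distributed_support_space:
      "simple_distributed (support_space p) X (pmf (map_pmf X p))"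
proof -
  show sp: "space (support_space p) = set_pmf p"
    by (simp add: support_space_def space_point_measure)
  have em: "emeasure (support_space p) A = emeasure (measure_pmf p) A" if "A \<subseteq> set_pmf p" for A
  proof -
    have "finite A" using fin that finite_subset by blast
    moreover have "A \<in> Pow (set_pmf p)" using that by simp
    ultimately show ?thesis unfolding support_space_def
      using fin that by (subst emeasure_point_measure_finite) (auto simp: emeasure_measure_pmf_finite)
  qed
  have pr: "prob_space (support_space p)"
    by standard (simp add: sp em emeasure_pmf)
  then show "information_space (support_space p) 2"
    by (simp add: information_space_def information_space_axioms_def)
  interpret prob_space "support_space p" by (rule pr)
  show "simple_distributed (support_space p) X (pmf (map_pmf X p))"
  proof (rule simple_distributedI)
    show "simple_function (support_space p) X"
      unfolding simple_function_def sp using fin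
      by (auto simp: support_space_def sets_point_measure)
    fix x
    have "pmf (map_pmf X p) x = measure (measure_pmf p) (X -` {x})"
      by (simp add: pmf_map)
    also have "\<dots> = measure (measure_pmf p) (X -` {x} \<inter> set_pmf p)"
      by (simp add: measure_Int_set_pmf)
    also have "\<dots> = measure (support_space p) (X -` {x} \<inter> set_pmf p)"
      by (simp add: measure_def em)
    finally show "pmf (map_pmf X p) x = measure (support_space p) (X -` {x} \<inter> space (support_space p))"
      by (simp add: sp)
  qed simp
qed

text \<open>The expectation form, instead of a sum over values, lets files and queries be averaged
  in either order later on.\<close>

lemma Ent_eq:
  assumes fin: "finite (set_pmf p)"
  shows "Ent p X = measure_pmf.expectation p (\<lambda>\<omega>. - log 2 (pmf (map_pmf X p) (X \<omega>)))"
proof -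
  interpret information_space "support_space p" 2
    by (rule information_space_support_space[OF fin])
  have "Ent p X = - (\<Sum>x\<in>X ` set_pmf p. pmf (map_pmf X p) x * log 2 (pmf (map_pmf X p) x))"
    using entropy_simple_distributed[OF simple_distributed_support_space[OF fin, of X]]
    by (simp add: Ent_def space_support_space[OF fin])
  then show ?thesis using sum_image_pmf[OF fin, of X "\<lambda>x. log 2 (pmf (map_pmf X p) x)"] by simp
qed

lemma Ent_le_log_card:
  assumes fin: "finite (set_pmf p)" and S: "X ` set_pmf p \<subseteq> S" "finite S"
  shows "Ent p X \<le> log 2 (card S)"
proof -
  interpret information_space "support_space p" 2
    by (rule information_space_support_space[OF fin])
  have "Ent p X \<le> log 2 (card (X ` set_pmf p))"
    using entropy_le_card[OF simple_distributed_support_space[OF fin, of X]]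
    by (simp add: Ent_def space_support_space[OF fin])
  also have "0 < card (X ` set_pmf p)" using fin set_pmf_not_empty by (simp add: card_gt_0_iff)
  then have "log 2 (card (X ` set_pmf p)) \<le> log 2 (card S)"
    using card_mono[OF S(2,1)] by simp
  finally show ?thesis .
qed

lemma CondEnt_eq:
  assumes fin: "finite (set_pmf p)"
  shows "CondEnt p X Y = measure_pmf.expectation p (\<lambda>\<omega>.
    - log 2 (pmf (map_pmf (\<lambda>\<omega>. (X \<omega>, Y \<omega>)) p) (X \<omega>, Y \<omega>) / pmf (map_pmf Y p) (Y \<omega>)))"
proof -
  interpret information_space "support_space p" 2
    by (rule information_space_support_space[OF fin])
  let ?P = "pmf (map_pmf (\<lambda>\<omega>. (X \<omega>, Y \<omega>)) p)"
  have "CondEnt p X Y = - (\<Sum>(x, y)\<in>(\<lambda>\<omega>. (X \<omega>, Y \<omega>)) ` set_pmf p.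
      ?P (x, y) * log 2 (?P (x, y) / pmf (map_pmf Y p) y))"
    using conditional_entropy_eq[OF simple_distributed_support_space[OF fin, of Y]
        simple_distributed_support_space[OF fin, of "\<lambda>\<omega>. (X \<omega>, Y \<omega>)"]]
    by (simp add: CondEnt_def space_support_space[OF fin])
  then show ?thesis
    using sum_image_pmf[OF fin, of "\<lambda>\<omega>. (X \<omega>, Y \<omega>)"
        "\<lambda>(x, y). log 2 (?P (x, y) / pmf (map_pmf Y p) y)"]
    by (simp add: case_prod_unfold)
qed

lemma CondMutInf_eq:
  assumes fin: "finite (set_pmf p)"
  shows "CondMutInf p X Y Z = measure_pmf.expectation p (\<lambda>\<omega>.
    log 2 (pmf (map_pmf (\<lambda>\<omega>. (X \<omega>, Y \<omega>, Z \<omega>)) p) (X \<omega>, Y \<omega>, Z \<omega>) /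
      (pmf (map_pmf (\<lambda>\<omega>. (X \<omega>, Z \<omega>)) p) (X \<omega>, Z \<omega>) *
       (pmf (map_pmf (\<lambda>\<omega>. (Y \<omega>, Z \<omega>)) p) (Y \<omega>, Z \<omega>) / pmf (map_pmf Z p) (Z \<omega>)))))"
proof -
  interpret information_space "support_space p" 2
    by (rule information_space_support_space[OF fin])
  let ?P = "pmf (map_pmf (\<lambda>\<omega>. (X \<omega>, Y \<omega>, Z \<omega>)) p)"
  let ?R = "\<lambda>(x, y, z). log 2 (?P (x, y, z) / (pmf (map_pmf (\<lambda>\<omega>. (X \<omega>, Z \<omega>)) p) (x, z) *
       (pmf (map_pmf (\<lambda>\<omega>. (Y \<omega>, Z \<omega>)) p) (y, z) / pmf (map_pmf Z p) z)))"
  have "CondMutInf p X Y Z = (\<Sum>w\<in>(\<lambda>\<omega>. (X \<omega>, Y \<omega>, Z \<omega>)) ` set_pmf p. ?P w * ?R w)"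
    using conditional_mutual_information_eq[OF simple_distributed_support_space[OF fin, of Z]
        simple_distributed_support_space[OF fin, of "\<lambda>\<omega>. (Y \<omega>, Z \<omega>)"]
        simple_distributed_support_space[OF fin, of "\<lambda>\<omega>. (X \<omega>, Z \<omega>)"]
        simple_distributed_support_space[OF fin, of "\<lambda>\<omega>. (X \<omega>, Y \<omega>, Z \<omega>)"]]
    by (simp add: CondMutInf_def space_support_space[OF fin] case_prod_unfold)
  then show ?thesis
    using sum_image_pmf[OF fin, of "\<lambda>\<omega>. (X \<omega>, Y \<omega>, Z \<omega>)" ?R] by simp
qed

section \<open>When conditional entropy and conditional mutual information vanish\<close>

lemma expectation_nonneg_eq_0_iff:
  fixes g :: "'a \<Rightarrow> real"
  assumes fin: "finite (set_pmf p)" and nn: "\<And>x. x \<in> set_pmf p \<Longrightarrow> g x \<ge> 0"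
  shows "measure_pmf.expectation p g = 0 \<longleftrightarrow> (\<forall>x\<in>set_pmf p. g x = 0)"
proof -
  have "measure_pmf.expectation p g = (\<Sum>x\<in>set_pmf p. g x * pmf p x)"
    by (intro integral_measure_pmf_real fin) auto
  also have "\<dots> = 0 \<longleftrightarrow> (\<forall>x\<in>set_pmf p. g x * pmf p x = 0)"
    using nn by (intro sum_nonneg_eq_0_iff fin) simp
  also have "\<dots> \<longleftrightarrow> (\<forall>x\<in>set_pmf p. g x = 0)"
    by (auto simp: set_pmf_iff)
  finally show ?thesis .
qed

lemma pmf_map_pos: "\<omega> \<in> set_pmf p \<Longrightarrow> pmf (map_pmf X p) (X \<omega>) > 0"
  by (simp add: pmf_positive)

text \<open>A joint probability never exceeds the marginal one, so the integrand is nonnegative and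
  a zero mean makes it vanish on the whole support. There the two probabilities agree, which leaves
  no mass for another value of \<open>X\<close> with the same \<open>Y\<close>. This turns
  decodability into: equal observations force equal files.\<close>

lemma CondEnt_eq_0_iff:
  assumes fin: "finite (set_pmf p)"
  shows "CondEnt p X Y = 0 \<longleftrightarrow> (\<forall>\<omega>\<in>set_pmf p. \<forall>\<omega>'\<in>set_pmf p. Y \<omega> = Y \<omega>' \<longrightarrow> X \<omega> = X \<omega>')"
proof -
  let ?XY = "\<lambda>\<omega>. (X \<omega>, Y \<omega>)"
  have le: "pmf (map_pmf ?XY p) (?XY \<omega>) \<le> pmf (map_pmf Y p) (Y \<omega>)" for \<omega>
    by (auto simp: pmf_map intro!: measure_pmf.finite_measure_mono)
  have "CondEnt p X Y = 0 \<longleftrightarrow>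
      (\<forall>\<omega>\<in>set_pmf p. - log 2 (pmf (map_pmf ?XY p) (?XY \<omega>) / pmf (map_pmf Y p) (Y \<omega>)) = 0)"
    unfolding CondEnt_eq[OF fin]
  proof (rule expectation_nonneg_eq_0_iff[OF fin])
    fix \<omega> assume \<omega>: "\<omega> \<in> set_pmf p"
    show "0 \<le> - log 2 (pmf (map_pmf ?XY p) (?XY \<omega>) / pmf (map_pmf Y p) (Y \<omega>))"
      using le[of \<omega>] pmf_map_pos[OF \<omega>, of ?XY] pmf_map_pos[OF \<omega>, of Y] by simp
  qed
  also have "\<dots> \<longleftrightarrow> (\<forall>\<omega>\<in>set_pmf p. pmf (map_pmf Y p) (Y \<omega>) = pmf (map_pmf ?XY p) (?XY \<omega>))"
  proof (intro ball_cong refl)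
    fix \<omega> assume \<omega>: "\<omega> \<in> set_pmf p"
    show "- log 2 (pmf (map_pmf ?XY p) (?XY \<omega>) / pmf (map_pmf Y p) (Y \<omega>)) = 0 \<longleftrightarrow>
        pmf (map_pmf Y p) (Y \<omega>) = pmf (map_pmf ?XY p) (?XY \<omega>)"
      using pmf_map_pos[OF \<omega>, of ?XY] pmf_map_pos[OF \<omega>, of Y]
      by (auto simp: log_def ln_div)
  qed
  also have "\<dots> \<longleftrightarrow> (\<forall>\<omega>\<in>set_pmf p. \<forall>\<omega>'\<in>set_pmf p. Y \<omega> = Y \<omega>' \<longrightarrow> X \<omega> = X \<omega>')"
  proof (intro ball_cong refl)
    fix \<omega> assume \<omega>: "\<omega> \<in> set_pmf p"
    \<comment> \<open>The event that \<open>Y\<close> has the same value but \<open>X\<close> a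
      different one; its mass is the gap between the two probabilities.\<close>
    let ?D = "Y -` {Y \<omega>} - ?XY -` {?XY \<omega>}"
    have "measure p ?D = pmf (map_pmf Y p) (Y \<omega>) - pmf (map_pmf ?XY p) (?XY \<omega>)"
      unfolding pmf_map by (intro measure_pmf.finite_measure_Diff) auto
    then have "pmf (map_pmf Y p) (Y \<omega>) = pmf (map_pmf ?XY p) (?XY \<omega>) \<longleftrightarrow> measure p ?D = 0"
      by auto
    also have "\<dots> \<longleftrightarrow> set_pmf p \<inter> ?D = {}"
      by (simp add: measure_pmf_zero_iff)
    also have "\<dots> \<longleftrightarrow> (\<forall>\<omega>'\<in>set_pmf p. Y \<omega> = Y \<omega>' \<longrightarrow> X \<omega> = X \<omega>')"
      by auto
    finally show "pmf (map_pmf Y p) (Y \<omega>) = pmf (map_pmf ?XY p) (?XY \<omega>) \<longleftrightarrow>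
        (\<forall>\<omega>'\<in>set_pmf p. Y \<omega> = Y \<omega>' \<longrightarrow> X \<omega> = X \<omega>')" .
  qed
  finally show ?thesis .
qed

lemma sum_pmf_pair_fst:
  assumes "finite S" "X ` set_pmf p \<subseteq> S"
  shows "(\<Sum>x\<in>S. pmf (map_pmf (\<lambda>\<omega>. (X \<omega>, Z \<omega>)) p) (x, z)) = pmf (map_pmf Z p) z"
proof -
  have "pmf (map_pmf Z p) z = measure p (Z -` {z} \<inter> set_pmf p)"
    by (simp add: pmf_map measure_Int_set_pmf)
  also have "Z -` {z} \<inter> set_pmf p = (\<Union>x\<in>S. (\<lambda>\<omega>. (X \<omega>, Z \<omega>)) -` {(x, z)} \<inter> set_pmf p)"
    using assms(2) by auto
  also have "measure p \<dots> = (\<Sum>x\<in>S. measure p ((\<lambda>\<omega>. (X \<omega>, Z \<omega>)) -` {(x, z)} \<inter> set_pmf p))"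
    using assms(1) by (intro measure_pmf.finite_measure_finite_Union) (auto simp: disjoint_family_on_def)
  finally show ?thesis by (simp add: pmf_map measure_Int_set_pmf)
qed

text \<open>Conditional mutual information is the divergence of the joint law from the law that
  makes \<open>X\<close> and \<open>Y\<close> independent given \<open>Z\<close>, and it vanishes
  only if the two coincide. The equation is cleared of denominators so that it also holds for values
  \<open>z\<close> of probability zero.\<close>

lemma CondMutInf_eq_0_iff:
  assumes fin: "finite (set_pmf p)"
  shows "CondMutInf p X Y Z = 0 \<longleftrightarrow> (\<forall>x y z.
    pmf (map_pmf (\<lambda>\<omega>. (X \<omega>, Y \<omega>, Z \<omega>)) p) (x, y, z) * pmf (map_pmf Z p) z =
    pmf (map_pmf (\<lambda>\<omega>. (X \<omega>, Z \<omega>)) p) (x, z) * pmf (map_pmf (\<lambda>\<omega>. (Y \<omega>, Z \<omega>)) p) (y, z))"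
    (is "_ \<longleftrightarrow> (\<forall>x y z. ?P (x, y, z) * ?Pz z = ?Px (x, z) * ?Py (y, z))")
proof
  let ?T = "\<lambda>\<omega>. (X \<omega>, Y \<omega>, Z \<omega>)"
  have pos: "?P (?T \<omega>) > 0" "?Pz (Z \<omega>) > 0" "?Px (X \<omega>, Z \<omega>) > 0" "?Py (Y \<omega>, Z \<omega>) > 0"
    if "\<omega> \<in> set_pmf p" for \<omega>
    using pmf_map_pos[OF that, of ?T] pmf_map_pos[OF that, of Z]
      pmf_map_pos[OF that, of "\<lambda>\<omega>. (X \<omega>, Z \<omega>)"] pmf_map_pos[OF that, of "\<lambda>\<omega>. (Y \<omega>, Z \<omega>)"]
    by auto
  {
    assume *: "\<forall>x y z. ?P (x, y, z) * ?Pz z = ?Px (x, z) * ?Py (y, z)"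
    have "CondMutInf p X Y Z = measure_pmf.expectation p (\<lambda>\<omega>. 0)"
      unfolding CondMutInf_eq[OF fin]
    proof (intro integral_cong_AE, simp, simp, rule AE_pmfI)
      fix \<omega> assume "\<omega> \<in> set_pmf p"
      note pos[OF this]
      moreover have "?P (?T \<omega>) * ?Pz (Z \<omega>) = ?Px (X \<omega>, Z \<omega>) * ?Py (Y \<omega>, Z \<omega>)"
        using * by blast
      ultimately have "?P (?T \<omega>) / (?Px (X \<omega>, Z \<omega>) * (?Py (Y \<omega>, Z \<omega>) / ?Pz (Z \<omega>))) = 1"
        by (simp add: field_simps)
      then show "log 2 (?P (?T \<omega>) / (?Px (X \<omega>, Z \<omega>) * (?Py (Y \<omega>, Z \<omega>) / ?Pz (Z \<omega>)))) = 0"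
        by (simp only: log_one)
    qed
    then show "CondMutInf p X Y Z = 0" by simp
  }
  assume zero: "CondMutInf p X Y Z = 0"
  \<comment> \<open>the equality case of Gibbs' inequality for the laws \<open>?P\<close> and \<open>q\<close>\<close>
  define q where "q = (\<lambda>(x, y, z). ?Px (x, z) * ?Py (y, z) / ?Pz z)"
  \<comment> \<open>The product of the ranges may be larger than the support of \<open>?P\<close>.
    The law \<open>q\<close> has total mass 1 on \<open>U\<close>, so its mass on the support is at
    most 1.\<close>
  define U where "U = X ` set_pmf p \<times> Y ` set_pmf p \<times> Z ` set_pmf p"
  have finU: "finite U" using fin by (simp add: U_def)
  have q_nonneg: "q w \<ge> 0" for w by (cases w) (simp add: q_def)
  have "(\<Sum>w\<in>U. q w) = (\<Sum>z\<in>Z ` set_pmf p. \<Sum>y\<in>Y ` set_pmf p. \<Sum>x\<in>X ` set_pmf p. q (x, y, z))"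
  proof -
    have "(\<Sum>w\<in>U. q w) = (\<Sum>x\<in>X ` set_pmf p. \<Sum>y\<in>Y ` set_pmf p. \<Sum>z\<in>Z ` set_pmf p. q (x, y, z))"
      by (simp add: U_def sum.cartesian_product)
    also have "\<dots> = (\<Sum>y\<in>Y ` set_pmf p. \<Sum>x\<in>X ` set_pmf p. \<Sum>z\<in>Z ` set_pmf p. q (x, y, z))"
      by (rule sum.swap)
    also have "\<dots> = (\<Sum>y\<in>Y ` set_pmf p. \<Sum>z\<in>Z ` set_pmf p. \<Sum>x\<in>X ` set_pmf p. q (x, y, z))"
      by (intro sum.cong refl sum.swap)
    also have "\<dots> = (\<Sum>z\<in>Z ` set_pmf p. \<Sum>y\<in>Y ` set_pmf p. \<Sum>x\<in>X ` set_pmf p. q (x, y, z))"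
      by (rule sum.swap)
    finally show ?thesis .
  qed
  also have "\<dots> = (\<Sum>z\<in>Z ` set_pmf p. ?Pz z * ?Pz z / ?Pz z)"
  proof (intro sum.cong refl)
    fix z
    have "(\<Sum>y\<in>Y ` set_pmf p. \<Sum>x\<in>X ` set_pmf p. q (x, y, z)) =
        (\<Sum>x\<in>X ` set_pmf p. ?Px (x, z)) * (\<Sum>y\<in>Y ` set_pmf p. ?Py (y, z)) / ?Pz z"
      by (simp add: q_def sum_divide_distrib sum_distrib_left sum_distrib_right)
    then show "(\<Sum>y\<in>Y ` set_pmf p. \<Sum>x\<in>X ` set_pmf p. q (x, y, z)) = ?Pz z * ?Pz z / ?Pz z"
      using fin by (simp add: sum_pmf_pair_fst)
  qed
  also have "\<dots> = (\<Sum>z\<in>Z ` set_pmf p. ?Pz z)"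
    by (intro sum.cong) auto
  also have "\<dots> = 1"
    using fin by (intro sum_pmf_eq_1) auto
  finally have sum_q: "(\<Sum>w\<in>U. q w) = 1" .
  have TU: "?T ` set_pmf p \<subseteq> U" by (auto simp: U_def)
  let ?g = "\<lambda>\<omega>. q (?T \<omega>) / ?P (?T \<omega>)"
  have int: "integrable p (h :: _ \<Rightarrow> real)" for h
    by (rule integrable_measure_pmf_finite[OF fin])
  have "measure_pmf.expectation p ?g = (\<Sum>w\<in>?T ` set_pmf p. ?P w * (q w / ?P w))"
    using sum_image_pmf[OF fin, of ?T "\<lambda>w. q w / ?P w"] by simp
  also have "\<dots> = (\<Sum>w\<in>?T ` set_pmf p. q w)"
  proof (intro sum.cong refl)
    fix w assume "w \<in> ?T ` set_pmf p"
    then show "?P w * (q w / ?P w) = q w" using pos(1) by force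
  qed
  finally have Eg: "measure_pmf.expectation p ?g = (\<Sum>w\<in>?T ` set_pmf p. q w)" .
  also have "\<dots> \<le> 1" unfolding sum_q[symmetric]
    using finU TU q_nonneg by (intro sum_mono2) auto
  finally have Eg_le: "measure_pmf.expectation p ?g \<le> 1" .
  have g_pos: "?g \<omega> > 0" if "\<omega> \<in> set_pmf p" for \<omega>
    using pos[OF that] by (simp add: q_def)
  have ln_g: "measure_pmf.expectation p (\<lambda>\<omega>. ln (?g \<omega>)) = 0"
  proof -
    have "measure_pmf.expectation p (\<lambda>\<omega>. ln (?g \<omega>)) =
        measure_pmf.expectation p (\<lambda>\<omega>. - ln 2 * log 2
          (?P (?T \<omega>) / (?Px (X \<omega>, Z \<omega>) * (?Py (Y \<omega>, Z \<omega>) / ?Pz (Z \<omega>)))))"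
    proof (intro integral_cong_AE, simp, simp, rule AE_pmfI)
      fix \<omega> assume "\<omega> \<in> set_pmf p"
      note p = pos[OF this]
      have "?g \<omega> = inverse (?P (?T \<omega>) / (?Px (X \<omega>, Z \<omega>) * (?Py (Y \<omega>, Z \<omega>) / ?Pz (Z \<omega>))))"
        by (simp add: q_def)
      then show "ln (?g \<omega>) = - ln 2 * log 2
          (?P (?T \<omega>) / (?Px (X \<omega>, Z \<omega>) * (?Py (Y \<omega>, Z \<omega>) / ?Pz (Z \<omega>))))"
        using p by (simp only: ln_inverse) (simp add: log_def)
    qed
    also have "\<dots> = - ln 2 * CondMutInf p X Y Z"
      unfolding CondMutInf_eq[OF fin] by simp
    finally show ?thesis using zero by simp
  qed
  \<comment> \<open>Pointwise \<open>?h\<close> is nonnegative, while its mean is that of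
    \<open>?g\<close> minus 1, hence at most 0. So \<open>?h\<close> vanishes and \<open>?g\<close>
    is 1 on the support.\<close>
  let ?h = "\<lambda>\<omega>. ?g \<omega> - 1 - ln (?g \<omega>)"
  have Eh: "measure_pmf.expectation p ?h = measure_pmf.expectation p ?g - 1"
    using ln_g by (subst Bochner_Integration.integral_diff[OF int int],
        subst Bochner_Integration.integral_diff[OF int int]) simp
  have h_nonneg: "?h \<omega> \<ge> 0" if "\<omega> \<in> set_pmf p" for \<omega>
    using ln_le_minus_one[OF g_pos[OF that]] by simp
  have "measure_pmf.expectation p ?h \<ge> 0"
    using h_nonneg by (intro integral_nonneg_AE AE_pmfI) simp
  then have Eh0: "measure_pmf.expectation p ?h = 0" using Eg_le Eh by simp
  then have *: "?h \<omega> = 0" if "\<omega> \<in> set_pmf p" for \<omega>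
    using expectation_nonneg_eq_0_iff[OF fin h_nonneg] that by simp
  have g1: "?g \<omega> = 1" if "\<omega> \<in> set_pmf p" for \<omega>
    by (rule ln_eq_minus_one[OF g_pos[OF that]]) (use *[OF that] in linarith)
  have on: "q w = ?P w" if w: "w \<in> ?T ` set_pmf p" for w
  proof -
    obtain \<omega> where "\<omega> \<in> set_pmf p" "w = ?T \<omega>" using w by blast
    then show ?thesis using g1[of \<omega>] pos(1)[of \<omega>] by (simp add: field_simps)
  qed
  \<comment> \<open>The mean of \<open>?g\<close> turned out to be exactly 1, so \<open>q\<close>
    spends its whole mass on the support and must vanish elsewhere in \<open>U\<close>, as
    \<open>?P\<close> does.\<close>
  have "(\<Sum>w\<in>U - ?T ` set_pmf p. q w) = 0"
    using sum.subset_diff[OF TU finU, of q] sum_q Eg Eh Eh0 by simp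
  then have off: "q w = 0" if "w \<in> U - ?T ` set_pmf p" for w
    using sum_nonneg_eq_0_iff[of "U - ?T ` set_pmf p" q] finU q_nonneg that by auto
  show "\<forall>x y z. ?P (x, y, z) * ?Pz z = ?Px (x, z) * ?Py (y, z)"
  proof (intro allI)
    fix x y z
    have off0: "?P w = 0" if "w \<notin> ?T ` set_pmf p" for w
      using that by (simp add: pmf_eq_0_set_pmf)
    show "?P (x, y, z) * ?Pz z = ?Px (x, z) * ?Py (y, z)"
    proof (cases "(x, y, z) \<in> U")
      case True
      then have "?Pz z > 0" using pos(2) by (auto simp: U_def)
      moreover have "?P (x, y, z) = q (x, y, z)"
        using on off off0 True by (cases "(x, y, z) \<in> ?T ` set_pmf p") auto
      ultimately show ?thesis by (simp add: q_def)
    next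
      case False
      then have "?P (x, y, z) = 0" using TU off0 by blast
      moreover have "?Px (x, z) = 0 \<or> ?Py (y, z) = 0"
        using False by (auto simp: U_def pmf_eq_0_set_pmf)
      ultimately show ?thesis by auto
    qed
  qed
qed

section \<open>Files determined by a grid of answers\<close>

text \<open>Fubini for finite supports. Both orders are stated because the side to integrate first
  depends on whether two cells lie in one column.\<close>

lemma expectation_pair_pmf:
  fixes g :: "'a \<times> 'b \<Rightarrow> real"
  assumes p: "finite (set_pmf p)" and q: "finite (set_pmf q)"
  shows "measure_pmf.expectation (pair_pmf p q) g =
    measure_pmf.expectation p (\<lambda>x. measure_pmf.expectation q (\<lambda>y. g (x, y)))"
    and "measure_pmf.expectation (pair_pmf p q) g =
    measure_pmf.expectation q (\<lambda>y. measure_pmf.expectation p (\<lambda>x. g (x, y)))"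
proof -
  have *: "measure_pmf.expectation (pair_pmf p q) g =
      (\<Sum>x\<in>set_pmf p. \<Sum>y\<in>set_pmf q. g (x, y) * (pmf p x * pmf q y))"
    using p q by (subst integral_measure_pmf_real[of "set_pmf p \<times> set_pmf q"])
      (auto simp: sum.cartesian_product pmf_pair intro!: sum.cong)
  show "measure_pmf.expectation (pair_pmf p q) g =
      measure_pmf.expectation p (\<lambda>x. measure_pmf.expectation q (\<lambda>y. g (x, y)))"
    unfolding * using p q
    by (simp add: integral_measure_pmf_real[of "set_pmf p"] integral_measure_pmf_real[of "set_pmf q"]
        sum_distrib_left mult_ac)
  show "measure_pmf.expectation (pair_pmf p q) g =
      measure_pmf.expectation q (\<lambda>y. measure_pmf.expectation p (\<lambda>x. g (x, y)))"
    unfolding * using p q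
    by (subst sum.swap)
      (simp add: integral_measure_pmf_real[of "set_pmf p"] integral_measure_pmf_real[of "set_pmf q"]
        sum_distrib_left mult_ac)
qed

text \<open>Splitting coordinate \<open>i\<close> off the product leaves an independent product in
  which \<open>j\<close> is an ordinary component.\<close>

lemma map_pmf_Pi_pmf_two:
  assumes "finite I" "i \<in> I" "j \<in> I" "i \<noteq> j"
  shows "map_pmf (\<lambda>x. (x i, x j)) (Pi_pmf I d (\<lambda>_. p)) = pair_pmf p p"
proof -
  define J where "J = I - {i}"
  have J: "finite J" "i \<notin> J" "j \<in> J" "I = insert i J" using assms by (auto simp: J_def)
  have "map_pmf (\<lambda>x. (x i, x j)) (Pi_pmf I d (\<lambda>_. p)) =
      map_pmf (\<lambda>(y, f). (y, f j)) (pair_pmf p (Pi_pmf J d (\<lambda>_. p)))"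
    using J assms(4) by (simp add: Pi_pmf_insert map_pmf_comp case_prod_unfold)
  also have "\<dots> = pair_pmf (map_pmf (\<lambda>y. y) p) (map_pmf (\<lambda>f. f j) (Pi_pmf J d (\<lambda>_. p)))"
    by (rule map_pair)
  also have "\<dots> = pair_pmf p p"
    using J by (simp add: Pi_pmf_component)
  finally show ?thesis .
qed

lemma expectation_Pi_pmf_component:
  fixes g :: "'b \<Rightarrow> real"
  assumes "finite I" "i \<in> I"
  shows "measure_pmf.expectation (Pi_pmf I d (\<lambda>_. p)) (\<lambda>x. g (x i)) = measure_pmf.expectation p g"
proof -
  have "measure_pmf.expectation (Pi_pmf I d (\<lambda>_. p)) (\<lambda>x. g (x i)) =
      measure_pmf.expectation (map_pmf (\<lambda>x. x i) (Pi_pmf I d (\<lambda>_. p))) g" by simp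
  also have "map_pmf (\<lambda>x. x i) (Pi_pmf I d (\<lambda>_. p)) = p"
    using assms by (simp add: Pi_pmf_component)
  finally show ?thesis .
qed

lemma expectation_Pi_pmf_mult:
  fixes g h :: "'b \<Rightarrow> real"
  assumes "finite I" "i \<in> I" "j \<in> I" "i \<noteq> j" and fin: "finite (set_pmf p)"
  shows "measure_pmf.expectation (Pi_pmf I d (\<lambda>_. p)) (\<lambda>x. g (x i) * h (x j)) =
    measure_pmf.expectation p g * measure_pmf.expectation p h"
proof -
  have "measure_pmf.expectation (Pi_pmf I d (\<lambda>_. p)) (\<lambda>x. g (x i) * h (x j)) =
      measure_pmf.expectation (map_pmf (\<lambda>x. (x i, x j)) (Pi_pmf I d (\<lambda>_. p))) (\<lambda>(a, b). g a * h b)"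
    by simp
  also have "\<dots> = measure_pmf.expectation p (\<lambda>a. measure_pmf.expectation p (\<lambda>b. g a * h b))"
    unfolding map_pmf_Pi_pmf_two[OF assms(1-4)] by (simp add: expectation_pair_pmf(1)[OF fin fin])
  finally show ?thesis by simp
qed

lemma finite_set_Pi_pmf:
  assumes "finite I" "finite (set_pmf p)"
  shows "finite (set_pmf (Pi_pmf I d (\<lambda>_. p)))"
  using assms by (simp add: set_Pi_pmf finite_PiE_dflt)

lemma expectation_mono_finite:
  fixes g h :: "'a \<Rightarrow> real"
  assumes "finite (set_pmf p)" "\<And>x. x \<in> set_pmf p \<Longrightarrow> g x \<le> h x"
  shows "measure_pmf.expectation p g \<le> measure_pmf.expectation p h"
  using assms by (intro integral_mono_AE integrable_measure_pmf_finite AE_pmfI)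

text \<open>Second moment method: \<open>f d a b\<close> plays the role of the probability that the demand is
  \<open>d\<close> given the queries \<open>a\<close> and \<open>b\<close>. On a grid of \<open>s\<close> independent
  queries to each server the demands attached to distinct cells are pairwise independent and
  uniform, so about \<open>s\<^sup>2\<close> of them are distinct.\<close>

lemma grid_bound:
  fixes p :: "'a pmf" and q :: "'b pmf" and f :: "'d \<Rightarrow> 'a \<Rightarrow> 'b \<Rightarrow> real"
    and \<beta> :: real
  assumes p: "finite (set_pmf p)" and q: "finite (set_pmf q)"
    and D: "finite D" "D \<noteq> {}"
    and nonneg: "\<And>d a b. f d a b \<ge> 0"
    and total: "\<And>a b. a \<in> set_pmf p \<Longrightarrow> b \<in> set_pmf q \<Longrightarrow> (\<Sum>d\<in>D. f d a b) = 1"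
    and uniform_p: "\<And>d b. d \<in> D \<Longrightarrow> b \<in> set_pmf q \<Longrightarrow>
      measure_pmf.expectation p (\<lambda>a. f d a b) = 1 / card D"
    and uniform_q: "\<And>d a. d \<in> D \<Longrightarrow> a \<in> set_pmf p \<Longrightarrow>
      measure_pmf.expectation q (\<lambda>b. f d a b) = 1 / card D"
    and s: "s * s \<le> card D" and \<beta>: "\<beta> \<ge> 0"
    and cost: "\<And>x y. (\<And>i. i < s \<Longrightarrow> x i \<in> set_pmf p) \<Longrightarrow> (\<And>j. j < s \<Longrightarrow> y j \<in> set_pmf q) \<Longrightarrow>
      \<beta> * card {d \<in> D. \<exists>i<s. \<exists>j<s. f d (x i) (y j) > 0} \<le> (\<Sum>i<s. c (x i)) + (\<Sum>j<s. e (y j))"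
  shows "\<beta> * (real s * real s / 2) \<le>
    real s * (measure_pmf.expectation p c + measure_pmf.expectation q e)"
proof -
  define X where "X = Pi_pmf {..<s} undefined (\<lambda>_. p)"
  define Y where "Y = Pi_pmf {..<s} undefined (\<lambda>_. q)"
  define R where "R = pair_pmf X Y"
  define n where "n = real (card D)"
  define J where "J = {..<s} \<times> {..<s}"
  \<comment> \<open>\<open>h d k z\<close> is the conditional probability of demand \<open>d\<close>
    at cell \<open>k\<close> of the grid \<open>z\<close>, \<open>F d z\<close> the expected number
    of cells with demand \<open>d\<close>, and \<open>G z\<close> the set of demands possible at
    some cell.\<close>
  define h where "h = (\<lambda>d k (x :: nat \<Rightarrow> 'a, y :: nat \<Rightarrow> 'b). f d (x (fst k)) (y (snd k)))"
  define F where "F = (\<lambda>d z. \<Sum>k\<in>J. h d k z)"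
  define G where "G = (\<lambda>z. {d \<in> D. \<exists>k\<in>J. h d k z > 0})"
  have n: "n > 0" using D by (simp add: n_def card_gt_0_iff)
  have J: "finite J" "real (card J) = real s * real s" by (simp_all add: J_def)
  have finX: "finite (set_pmf X)" and finY: "finite (set_pmf Y)"
    using p q by (auto simp: X_def Y_def intro!: finite_set_Pi_pmf)
  have finR: "finite (set_pmf R)" using finX finY by (simp add: R_def)
  have int: "integrable R (g :: _ \<Rightarrow> real)" for g
    by (rule integrable_measure_pmf_finite[OF finR])
  have xX: "x i \<in> set_pmf p" if "x \<in> set_pmf X" "i < s" for x i
    using that by (auto simp: X_def set_Pi_pmf PiE_dflt_def)
  have yY: "y i \<in> set_pmf q" if "y \<in> set_pmf Y" "i < s" for y i
    using that by (auto simp: Y_def set_Pi_pmf PiE_dflt_def)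
  have hn: "h d k z \<ge> 0" for d k z by (simp add: h_def nonneg split: prod.split)
  have h_total: "(\<Sum>d\<in>D. h d k z) = 1" if "z \<in> set_pmf R" "k \<in> J" for k z
    using that xX yY by (auto simp: R_def J_def h_def intro!: total)
  have h_le: "h d k z \<le> 1" if "z \<in> set_pmf R" "k \<in> J" "d \<in> D" for d k z
    using member_le_sum[of d D "\<lambda>d. h d k z"] D that hn h_total[OF that(1,2)] by simp

  have off_diagonal: "measure_pmf.expectation R (\<lambda>z. h d k z * h d k' z) = 1 / n * (1 / n)"
    if k: "k \<in> J" "k' \<in> J" "k \<noteq> k'" and d: "d \<in> D" for d k k'
  proof -
    obtain i j i' j' where kk: "k = (i, j)" "k' = (i', j')" by fastforce
    then have lt: "i < s" "j < s" "i' < s" "j' < s" using k by (auto simp: J_def)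
    show ?thesis
    \<comment> \<open>In distinct columns the server-2 queries are independent, and for every fixed
      server-1 query the average over one of them is \<open>1 / n\<close>, even when the rows
      coincide. In a common column the rows differ and the roles are exchanged.\<close>
    proof (cases "j = j'")
      case False
      have "measure_pmf.expectation R (\<lambda>z. h d k z * h d k' z) =
          measure_pmf.expectation X (\<lambda>x. measure_pmf.expectation Y (\<lambda>y. f d (x i) (y j) * f d (x i') (y j')))"
        unfolding R_def expectation_pair_pmf(1)[OF finX finY] by (simp add: h_def kk)
      also have "\<dots> = measure_pmf.expectation X (\<lambda>x. 1 / n * (1 / n))"
      proof (intro integral_cong_AE AE_pmfI)
        fix x assume x: "x \<in> set_pmf X"
        have "measure_pmf.expectation Y (\<lambda>y. f d (x i) (y j) * f d (x i') (y j')) =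
            measure_pmf.expectation q (f d (x i)) * measure_pmf.expectation q (f d (x i'))"
          unfolding Y_def using lt False q by (intro expectation_Pi_pmf_mult) auto
        then show "measure_pmf.expectation Y (\<lambda>y. f d (x i) (y j) * f d (x i') (y j')) = 1 / n * (1 / n)"
          using uniform_q[OF d xX[OF x]] lt by (simp add: n_def)
      qed simp_all
      finally show ?thesis by simp
    next
      case True
      then have ii: "i \<noteq> i'" using k kk by auto
      have "measure_pmf.expectation R (\<lambda>z. h d k z * h d k' z) =
          measure_pmf.expectation Y (\<lambda>y. measure_pmf.expectation X (\<lambda>x. f d (x i) (y j) * f d (x i') (y j')))"
        unfolding R_def expectation_pair_pmf(2)[OF finX finY] by (simp add: h_def kk)
      also have "\<dots> = measure_pmf.expectation Y (\<lambda>y. 1 / n * (1 / n))"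
      proof (intro integral_cong_AE AE_pmfI)
        fix y assume y: "y \<in> set_pmf Y"
        have "measure_pmf.expectation X (\<lambda>x. f d (x i) (y j) * f d (x i') (y j')) =
            measure_pmf.expectation p (\<lambda>a. f d a (y j)) * measure_pmf.expectation p (\<lambda>a. f d a (y j'))"
          unfolding X_def using lt ii p
          by (intro expectation_Pi_pmf_mult[where g = "\<lambda>a. f d a (y j)" and h = "\<lambda>a. f d a (y j')"]) auto
        then show "measure_pmf.expectation X (\<lambda>x. f d (x i) (y j) * f d (x i') (y j')) = 1 / n * (1 / n)"
          using uniform_p[OF d yY[OF y]] lt by (simp add: n_def)
      qed simp_all
      finally show ?thesis by simp
    qed
  qed
  \<comment> \<open>On the diagonal, \<open>h\<close> is at most 1, so its square is at most
    \<open>h\<close>, and the probabilities sum to 1. Off the diagonal, \<open>n\<close> demands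
    contribute \<open>1 / n * (1 / n)\<close> each.\<close>
  have pair_moment: "(\<Sum>d\<in>D. measure_pmf.expectation R (\<lambda>z. h d k z * h d k' z)) \<le>
      (if k = k' then 1 else 0) + 1 / n" if k: "k \<in> J" "k' \<in> J" for k k'
  proof (cases "k = k'")
    case True
    have "(\<Sum>d\<in>D. measure_pmf.expectation R (\<lambda>z. h d k z * h d k z)) \<le>
        (\<Sum>d\<in>D. measure_pmf.expectation R (\<lambda>z. h d k z))"
      using k hn h_le mult_left_mono[of "h _ k _" 1 "h _ k _"]
      by (intro sum_mono expectation_mono_finite[OF finR]) simp
    also have "\<dots> = measure_pmf.expectation R (\<lambda>z. \<Sum>d\<in>D. h d k z)"
      by (rule Bochner_Integration.integral_sum[symmetric, OF int])
    also have "\<dots> = measure_pmf.expectation R (\<lambda>z. 1)"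
      using h_total k by (intro integral_cong_AE AE_pmfI) auto
    finally have "(\<Sum>d\<in>D. measure_pmf.expectation R (\<lambda>z. h d k z * h d k z)) \<le> 1" by simp
    moreover have "0 \<le> 1 / n" using n by simp
    ultimately show ?thesis using True by (simp del: zero_le_divide_1_iff)
  next
    case False
    then show ?thesis using off_diagonal[OF k False] n by (simp add: n_def)
  qed

  have "(\<Sum>d\<in>D. measure_pmf.expectation R (\<lambda>z. (F d z)\<^sup>2)) =
      (\<Sum>d\<in>D. \<Sum>k\<in>J. \<Sum>k'\<in>J. measure_pmf.expectation R (\<lambda>z. h d k z * h d k' z))"
    by (simp add: F_def power2_eq_square sum_product Bochner_Integration.integral_sum[OF int])
  also have "\<dots> = (\<Sum>k\<in>J. \<Sum>k'\<in>J. \<Sum>d\<in>D. measure_pmf.expectation R (\<lambda>z. h d k z * h d k' z))"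
    by (subst sum.swap) (intro sum.cong refl sum.swap)
  also have "\<dots> \<le> (\<Sum>k\<in>J. \<Sum>k'\<in>J. (if k = k' then 1 else 0) + 1 / n)"
    using pair_moment by (intro sum_mono)
  \<comment> \<open>The diagonal contributes s^2 and all pairs together at most s^4/n, which s^2
    \<le> n bounds by s^2 again.\<close>
  also have "\<dots> = real s * real s * (1 + real s * real s / n)"
    using J by (simp add: sum.distrib algebra_simps)
  also have "\<dots> \<le> real s * real s * 2"
  proof (intro mult_left_mono)
    have "real s * real s \<le> n" unfolding n_def using s by (metis of_nat_le_iff of_nat_mult)
    then show "1 + real s * real s / n \<le> 2" using n by (simp add: field_simps)
  qed simp
  finally have second: "(\<Sum>d\<in>D. measure_pmf.expectation R (\<lambda>z. (F d z)\<^sup>2)) \<le> real s * real s * 2" .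

  \<comment> \<open>The function x - x^2/4 has maximum 1 and vanishes at 0, so at
    \<open>F d z\<close> it is at most the indicator of \<open>G z\<close>. Summed and averaged it
    is at least s^2 - 2 s^2/4, the source of the factor 1/2.\<close>
  have "real s * real s / 2 \<le>
      real s * real s - (\<Sum>d\<in>D. measure_pmf.expectation R (\<lambda>z. (F d z)\<^sup>2)) / 4"
    using second by simp
  also have "\<dots> = measure_pmf.expectation R (\<lambda>z. real s * real s - (\<Sum>d\<in>D. (F d z)\<^sup>2) / 4)"
    by (simp add: Bochner_Integration.integral_diff[OF int int] Bochner_Integration.integral_sum[OF int])
  also have "\<dots> \<le> measure_pmf.expectation R (\<lambda>z. card (G z))"
  proof (rule expectation_mono_finite[OF finR])
    fix z assume z: "z \<in> set_pmf R"
    have "(\<Sum>d\<in>D. F d z) = (\<Sum>k\<in>J. \<Sum>d\<in>D. h d k z)"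
      unfolding F_def by (rule sum.swap)
    also have "\<dots> = real s * real s" using h_total z J by simp
    finally have "real s * real s - (\<Sum>d\<in>D. (F d z)\<^sup>2) / 4 = (\<Sum>d\<in>D. F d z - (F d z)\<^sup>2 / 4)"
      by (simp add: sum_subtractf sum_divide_distrib)
    also have "\<dots> \<le> (\<Sum>d\<in>D. if d \<in> G z then 1 else 0)"
    proof (rule sum_mono)
      fix d assume d: "d \<in> D"
      show "F d z - (F d z)\<^sup>2 / 4 \<le> (if d \<in> G z then 1 else 0)"
      proof (cases "d \<in> G z")
        case True
        have "0 \<le> (F d z / 2 - 1)\<^sup>2" by simp
        then show ?thesis using True by (simp add: power2_eq_square field_simps)
      next
        case False
        then have "h d k z = 0" if "k \<in> J" for k
          using that d hn[of d k z] by (force simp: G_def)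
        then show ?thesis using False by (simp add: F_def)
      qed
    qed
    also have "\<dots> = card (G z)"
      using D by (simp add: sum.If_cases G_def Int_def conj_commute)
    finally show "real s * real s - (\<Sum>d\<in>D. (F d z)\<^sup>2) / 4 \<le> card (G z)" .
  qed
  finally have "\<beta> * (real s * real s / 2) \<le> \<beta> * measure_pmf.expectation R (\<lambda>z. card (G z))"
    using \<beta> by (rule mult_left_mono)
  also have "\<dots> = measure_pmf.expectation R (\<lambda>z. \<beta> * card (G z))" by simp
  also have "\<dots> \<le> measure_pmf.expectation R (\<lambda>z. (\<Sum>i<s. c (fst z i)) + (\<Sum>j<s. e (snd z j)))"
  proof (rule expectation_mono_finite[OF finR])
    fix z assume z: "z \<in> set_pmf R"
    obtain x y where zxy: "z = (x, y)" by fastforce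
    have "G z = {d \<in> D. \<exists>i<s. \<exists>j<s. f d (x i) (y j) > 0}"
      by (auto simp: G_def zxy h_def J_def)
    then show "\<beta> * card (G z) \<le> (\<Sum>i<s. c (fst z i)) + (\<Sum>j<s. e (snd z j))"
      using cost[of x y] z xX yY by (simp add: zxy R_def)
  qed
  also have "\<dots> = (\<Sum>i<s. measure_pmf.expectation X (\<lambda>x. c (x i))) + (\<Sum>j<s. measure_pmf.expectation Y (\<lambda>y. e (y j)))"
  proof -
    have "measure_pmf.expectation R (\<lambda>z. c (fst z i)) = measure_pmf.expectation X (\<lambda>x. c (x i))"
      "measure_pmf.expectation R (\<lambda>z. e (snd z i)) = measure_pmf.expectation Y (\<lambda>y. e (y i))" for i
      unfolding R_def by (simp_all add: expectation_pair_pmf(1)[OF finX finY])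
    then show ?thesis
      by (simp add: Bochner_Integration.integral_add[OF int int] Bochner_Integration.integral_sum[OF int])
  qed
  also have "\<dots> = real s * (measure_pmf.expectation p c + measure_pmf.expectation q e)"
    by (simp add: X_def Y_def expectation_Pi_pmf_component algebra_simps)
  finally show ?thesis .
qed

section \<open>Counting file families compatible with given answers\<close>

lemma bool_lists_length:
  shows finite_bool_lists_length: "finite {w :: bool list. length w = B}"
    and card_bool_lists_length: "card {w :: bool list. length w = B} = 2 ^ B"
  using finite_lists_length_eq[of "UNIV :: bool set" B] card_lists_length_eq[of "UNIV :: bool set" B]
  by simp_all

lemma finite_file_space: "finite (file_space N B)"
  by (auto simp: file_space_def finite_bool_lists_length intro!: finite_PiE)

lemma card_file_space: "card (file_space N B) = 2 ^ (B * N)"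
  by (simp add: file_space_def card_PiE card_bool_lists_length power_mult)

lemma file_space_not_empty: "file_space N B \<noteq> {}"
  using card_file_space[of N B] by force

text \<open>A family in \<open>S\<close> is determined by its files outside \<open>G\<close>, that
  is by \<open>B * (N - card G)\<close> bits. Outside \<open>{1..N}\<close> all families take the
  same default value, because \<open>file_space\<close> is extensional.\<close>

lemma card_agreeing_files_le:
  assumes G: "G \<subseteq> {1..N}" and S: "S \<subseteq> file_space N B"
    and agree: "\<And>w w' d. w \<in> S \<Longrightarrow> w' \<in> S \<Longrightarrow> d \<in> G \<Longrightarrow> w d = w' d"
  shows "card S \<le> 2 ^ (B * (N - card G))"
proof -
  let ?H = "{1..N} - G"
  have "inj_on (\<lambda>w. restrict w ?H) S"
  proof (rule inj_onI)
    fix w w' assume w: "w \<in> S" "w' \<in> S" and eq: "restrict w ?H = restrict w' ?H"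
    show "w = w'"
    proof
      fix d
      consider "d \<in> G" | "d \<in> ?H" | "d \<notin> {1..N}" by blast
      then show "w d = w' d"
      proof cases
        case 1 then show ?thesis using agree w by blast
      next
        case 2 then show ?thesis using fun_cong[OF eq, of d] by simp
      next
        case 3
        moreover have "w \<in> file_space N B" "w' \<in> file_space N B" using w S by auto
        ultimately show ?thesis unfolding file_space_def by (metis PiE_arb)
      qed
    qed
  qed
  then have "card S \<le> card (\<Pi>\<^sub>E n\<in>?H. {w :: bool list. length w = B})"
  proof (rule card_inj_on_le)
    show "(\<lambda>w. restrict w ?H) ` S \<subseteq> (\<Pi>\<^sub>E n\<in>?H. {w. length w = B})"
      using S by (fastforce simp: file_space_def)
    show "finite (\<Pi>\<^sub>E n\<in>?H. {w :: bool list. length w = B})"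
      by (intro finite_PiE) (auto simp: finite_bool_lists_length)
  qed
  also have "card ?H = N - card G"
    using G finite_subset[OF G] by (simp add: card_Diff_subset)
  then have "card (\<Pi>\<^sub>E n\<in>?H. {w :: bool list. length w = B}) = 2 ^ (B * (N - card G))"
    by (simp add: card_PiE card_bool_lists_length power_mult)
  finally show ?thesis .
qed

text \<open>The converse needs entropies of the answers averaged over the queries. Comparing with the
  product of arbitrary laws \<open>m k\<close>, later the marginal laws of the answers, gives subadditivity and
  the conditioning inequality at once.\<close>

lemma determined_files_le_cross_entropy:
  fixes v :: "'k \<Rightarrow> files \<Rightarrow> 'c" and m :: "'k \<Rightarrow> 'c pmf"
  assumes K: "finite K" and G: "G \<subseteq> {1..N}"
    and pos: "\<And>k w. k \<in> K \<Longrightarrow> w \<in> file_space N B \<Longrightarrow> pmf (m k) (v k w) > 0"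
    and determined: "\<And>w w' d. w \<in> file_space N B \<Longrightarrow> w' \<in> file_space N B \<Longrightarrow>
      (\<And>k. k \<in> K \<Longrightarrow> v k w = v k w') \<Longrightarrow> d \<in> G \<Longrightarrow> w d = w' d"
  shows "real B * real (card G) \<le>
    (\<Sum>k\<in>K. measure_pmf.expectation (pmf_of_set (file_space N B)) (\<lambda>w. - log 2 (pmf (m k) (v k w))))"
proof -
  define \<Omega> where "\<Omega> = file_space N B"
  \<comment> \<open>\<open>V w\<close> is the tuple of all answers, made extensional so that tuples
    range over a \<open>PiE\<close>, on which the product law \<open>M\<close> has mass at most
    1.\<close>
  define V where "V = (\<lambda>w. restrict (\<lambda>k. v k w) K)"
  define M where "M = (\<lambda>u. \<Prod>k\<in>K. pmf (m k) (u k))"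
  have \<Omega>: "finite \<Omega>" "\<Omega> \<noteq> {}" "card \<Omega> = 2 ^ (B * N)"
    by (simp_all add: \<Omega>_def finite_file_space file_space_not_empty card_file_space)
  have M_nonneg: "M u \<ge> 0" for u by (simp add: M_def prod_nonneg)
  have fiber: "card {w \<in> \<Omega>. V w = u} \<le> 2 ^ (B * (N - card G))" for u
  proof (rule card_agreeing_files_le[OF G])
    fix w w' d assume *: "w \<in> {w \<in> \<Omega>. V w = u}" "w' \<in> {w \<in> \<Omega>. V w = u}" "d \<in> G"
    then have eq: "V w = V w'" by simp
    have "v k w = v k w'" if "k \<in> K" for k
      using fun_cong[OF eq, of k] that by (simp add: V_def)
    then show "w d = w' d" using determined[of w w' d] * by (simp add: \<Omega>_def)
  qed (auto simp: \<Omega>_def)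
  have "(\<Sum>u\<in>V ` \<Omega>. M u) \<le> (\<Sum>u\<in>Pi\<^sub>E K (\<lambda>k. v k ` \<Omega>). M u)"
    using \<Omega> K M_nonneg by (intro sum_mono2 finite_PiE) (auto simp: V_def)
  also have "\<dots> = (\<Prod>k\<in>K. \<Sum>c\<in>v k ` \<Omega>. pmf (m k) c)"
    unfolding M_def using K \<Omega> by (subst prod_sum_PiE) auto
  also have "\<dots> \<le> 1"
    using \<Omega> by (intro prod_le_1) (auto simp: sum_nonneg measure_measure_pmf_finite[symmetric])
  finally have sumM: "(\<Sum>u\<in>V ` \<Omega>. M u) \<le> 1" .
  have "(\<Sum>w\<in>\<Omega>. M (V w)) = (\<Sum>u\<in>V ` \<Omega>. \<Sum>w\<in>{w \<in> \<Omega>. V w = u}. M (V w))"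
    using \<Omega> by (intro sum.image_gen)
  also have "\<dots> = (\<Sum>u\<in>V ` \<Omega>. real (card {w \<in> \<Omega>. V w = u}) * M u)"
    by (intro sum.cong refl) simp
  also have "\<dots> \<le> (\<Sum>u\<in>V ` \<Omega>. 2 ^ (B * (N - card G)) * M u)"
  proof (intro sum_mono mult_right_mono M_nonneg)
    fix u
    show "real (card {w \<in> \<Omega>. V w = u}) \<le> 2 ^ (B * (N - card G))"
      using fiber[of u] by (metis of_nat_le_iff of_nat_numeral of_nat_power)
  qed
  also have "\<dots> \<le> 2 ^ (B * (N - card G))"
    using sumM by (simp add: sum_distrib_left[symmetric])
  finally have sum_le: "(\<Sum>w\<in>\<Omega>. M (V w)) \<le> 2 ^ (B * (N - card G))" .
  have "card G \<le> N" using card_mono[OF _ G] by simp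
  then have split: "(2::real) ^ (B * card G) * 2 ^ (B * (N - card G)) = 2 ^ (B * N)"
    by (simp flip: power_add distrib_left)
  \<comment> \<open>The fiber bound limits the sum of \<open>M (V w)\<close> over all files; this
    scaling brings the average of \<open>?g\<close> over the \<open>2 ^ (B * N)\<close> families
    down to at most 1. By ln x \<le> x - 1 the average of its logarithm is then at most 0, which is
    the claim.\<close>
  let ?g = "\<lambda>w. 2 ^ (B * card G) * M (V w)"
  have ln_g: "ln (?g w) = real B * card G * ln 2 + (\<Sum>k\<in>K. ln (pmf (m k) (v k w)))"
    and g_pos: "?g w > 0" if w: "w \<in> \<Omega>" for w
  proof -
    have p: "pmf (m k) (v k w) > 0" if "k \<in> K" for k using pos that w by (simp add: \<Omega>_def)
    have M: "M (V w) = (\<Prod>k\<in>K. pmf (m k) (v k w))" by (simp add: M_def V_def)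
    then have Mpos: "M (V w) > 0" using p by (simp add: prod_pos)
    then show "?g w > 0" by simp
    have "ln (M (V w)) = (\<Sum>k\<in>K. ln (pmf (m k) (v k w)))"
      unfolding M using K by (intro ln_prod) (auto dest: p)
    then show "ln (?g w) = real B * card G * ln 2 + (\<Sum>k\<in>K. ln (pmf (m k) (v k w)))"
      using Mpos by (simp add: ln_mult_pos ln_realpow)
  qed
  have "(\<Sum>w\<in>\<Omega>. ln (?g w)) \<le> (\<Sum>w\<in>\<Omega>. ?g w - 1)"
    using g_pos by (intro sum_mono ln_le_minus_one)
  also have "\<dots> = 2 ^ (B * card G) * (\<Sum>w\<in>\<Omega>. M (V w)) - 2 ^ (B * N)"
    using \<Omega>(3) by (simp add: sum_subtractf sum_distrib_left)
  also have "\<dots> \<le> 0"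
    using mult_left_mono[OF sum_le, of "2 ^ (B * card G)"] split by simp
  finally have "(\<Sum>w\<in>\<Omega>. real B * card G * ln 2 + (\<Sum>k\<in>K. ln (pmf (m k) (v k w)))) \<le> 0"
    using ln_g by (simp cong: sum.cong)
  then have "real (card \<Omega>) * (real B * card G * ln 2) \<le> - (\<Sum>k\<in>K. \<Sum>w\<in>\<Omega>. ln (pmf (m k) (v k w)))"
    by (simp add: sum.distrib sum.swap[of _ K \<Omega>])
  then have "real (card \<Omega>) * (real B * card G) * ln 2 \<le>
      (\<Sum>k\<in>K. \<Sum>w\<in>\<Omega>. - log 2 (pmf (m k) (v k w))) * ln 2"
    by (simp add: log_def sum_negf mult_ac flip: sum_divide_distrib)
  then have "real (card \<Omega>) * (real B * card G) \<le> (\<Sum>k\<in>K. \<Sum>w\<in>\<Omega>. - log 2 (pmf (m k) (v k w)))"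
    by (rule mult_right_le_imp_le) simp
  moreover have "real (card \<Omega>) > 0" using \<Omega> by (simp add: card_gt_0_iff)
  ultimately have "real B * card G \<le> (\<Sum>k\<in>K. \<Sum>w\<in>\<Omega>. - log 2 (pmf (m k) (v k w))) / real (card \<Omega>)"
    by (simp add: field_simps)
  also have "\<dots> = (\<Sum>k\<in>K. measure_pmf.expectation (pmf_of_set \<Omega>) (\<lambda>w. - log 2 (pmf (m k) (v k w))))"
    unfolding sum_divide_distrib integral_pmf_of_set[OF \<Omega>(2,1)] ..
  finally show ?thesis by (simp add: \<Omega>_def)
qed

section \<open>The lower bound on the download cost\<close>

text \<open>The user's side of the experiment without the files. Since the files are independent of
  it, privacy and UDIQ are properties of this law alone.\<close>

definition user_law :: "pir \<Rightarrow> nat pmf \<Rightarrow> (nat \<times> nat \<times> nat) pmf" where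
  "user_law P D = do { k \<leftarrow> D; (q1, q2) \<leftarrow> query_law P k; return_pmf (k, q1, q2) }"

definition user :: "outcome \<Rightarrow> nat \<times> nat \<times> nat" where
  "user \<omega> = (demand \<omega>, Q1 \<omega>, Q2 \<omega>)"

abbreviation files_law :: "nat \<Rightarrow> pir \<Rightarrow> files pmf" where
  "files_law N P \<equiv> pmf_of_set (file_space N (file_bits P))"

lemma joint_law_eq:
  "joint_law N P D = map_pmf (\<lambda>(w, k, q1, q2). \<lparr>W = w, demand = k, Q1 = q1, Q2 = q2\<rparr>)
     (pair_pmf (files_law N P) (user_law P D))"
  by (simp add: joint_law_def user_law_def pair_pmf_def map_bind_pmf bind_assoc_pmf bind_return_pmf
      case_prod_unfold)

lemma map_pmf_joint_law:
  "map_pmf (\<lambda>\<omega>. g (W \<omega>) (user \<omega>)) (joint_law N P D) =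
   map_pmf (\<lambda>(w, u). g w u) (pair_pmf (files_law N P) (user_law P D))"
  by (simp add: joint_law_eq map_pmf_comp user_def case_prod_unfold)

lemma set_pmf_files_law: "set_pmf (files_law N P) = file_space N (file_bits P)"
  by (simp add: finite_file_space file_space_not_empty)

lemma set_pmf_user_law:
  "set_pmf (user_law P D) = {(k, q1, q2). k \<in> set_pmf D \<and> (q1, q2) \<in> set_pmf (query_law P k)}"
  by (force simp: user_law_def)

lemma set_pmf_joint_law:
  "\<omega> \<in> set_pmf (joint_law N P D) \<longleftrightarrow>
     W \<omega> \<in> file_space N (file_bits P) \<and> user \<omega> \<in> set_pmf (user_law P D)"
  by (cases \<omega>) (force simp: joint_law_eq user_def finite_file_space file_space_not_empty)

lemma finite_set_pmf_joint_law:
  "finite (set_pmf (user_law P D)) \<Longrightarrow> finite (set_pmf (joint_law N P D))"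
  by (simp add: joint_law_eq finite_file_space file_space_not_empty)

lemma finite_set_pmf_user_law:
  assumes "finite (set_pmf D)" "\<And>k. k \<in> set_pmf D \<Longrightarrow> finite (set_pmf (query_law P k))"
  shows "finite (set_pmf (user_law P D))"
proof -
  have "set_pmf (user_law P D) = (SIGMA k:set_pmf D. set_pmf (query_law P k))"
    by (auto simp: set_pmf_user_law)
  then show ?thesis using assms by simp
qed

lemma map_fst_user_law: "map_pmf fst (user_law P D) = D"
  by (simp add: user_law_def map_bind_pmf case_prod_unfold bind_return_pmf')

lemma pmf_map_joint_law:
  "pmf (map_pmf (\<lambda>\<omega>. (X (user \<omega>), W \<omega>)) (joint_law N P D)) (x, w) =
   pmf (map_pmf X (user_law P D)) x * pmf (files_law N P) w"
proof -
  have "map_pmf (\<lambda>\<omega>. (X (user \<omega>), W \<omega>)) (joint_law N P D) =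
      map_pmf (\<lambda>(w, u). (X u, w)) (pair_pmf (files_law N P) (user_law P D))"
    by (rule map_pmf_joint_law[where g = "\<lambda>w u. (X u, w)"])
  also have "\<dots> = map_pmf (\<lambda>(u, w). (X u, w)) (pair_pmf (user_law P D) (files_law N P))"
    by (subst pair_commute_pmf) (simp add: map_pmf_comp case_prod_unfold)
  also have "\<dots> = pair_pmf (map_pmf X (user_law P D)) (files_law N P)"
    using map_pair[of X "\<lambda>w. w"] by simp
  finally show ?thesis by (simp add: pmf_pair)
qed

text \<open>Conditioning on independent files changes nothing: in the product criterion the
  probability of the files factors out on both sides, and one family \<open>w0\<close> of positive
  probability suffices to cancel it.\<close>

lemma CondMutInf_user_eq_0_iff:
  assumes fin: "finite (set_pmf (user_law P D))"
  shows "CondMutInf (joint_law N P D) (\<lambda>\<omega>. X (user \<omega>)) (\<lambda>\<omega>. Y (user \<omega>)) W = 0 \<longleftrightarrow>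
    map_pmf (\<lambda>u. (X u, Y u)) (user_law P D) =
    pair_pmf (map_pmf X (user_law P D)) (map_pmf Y (user_law P D))"
    (is "_ \<longleftrightarrow> ?R")
proof -
  let ?p = "joint_law N P D" and ?\<mu> = "files_law N P" and ?U = "user_law P D"
  have XYW: "pmf (map_pmf (\<lambda>\<omega>. (X (user \<omega>), Y (user \<omega>), W \<omega>)) ?p) (x, y, w) =
      pmf (map_pmf (\<lambda>u. (X u, Y u)) ?U) (x, y) * pmf ?\<mu> w" for x y w
  proof -
    let ?s = "\<lambda>((x, y), w). (x, y, w)"
    have "map_pmf (\<lambda>\<omega>. (X (user \<omega>), Y (user \<omega>), W \<omega>)) ?p =
        map_pmf ?s (map_pmf (\<lambda>\<omega>. ((X (user \<omega>), Y (user \<omega>)), W \<omega>)) ?p)"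
      by (simp add: map_pmf_comp)
    also have "pmf \<dots> (?s ((x, y), w)) =
        pmf (map_pmf (\<lambda>\<omega>. ((X (user \<omega>), Y (user \<omega>)), W \<omega>)) ?p) ((x, y), w)"
      by (rule pmf_map_inj') (auto simp: inj_on_def)
    finally show ?thesis
      using pmf_map_joint_law[of "\<lambda>u. (X u, Y u)"] by simp
  qed
  have Wp: "pmf (map_pmf W ?p) w = pmf ?\<mu> w" for w
  proof -
    have "map_pmf W ?p = map_pmf fst (pair_pmf ?\<mu> ?U)"
      using map_pmf_joint_law[of "\<lambda>w u. w"] by (simp add: case_prod_unfold)
    then show ?thesis by (simp add: map_fst_pair_pmf)
  qed
  obtain w0 where w0: "pmf ?\<mu> w0 > 0"
    using file_space_not_empty finite_file_space set_pmf_files_law[of N P] by (metis all_not_in_conv pmf_positive)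
  have "CondMutInf ?p (\<lambda>\<omega>. X (user \<omega>)) (\<lambda>\<omega>. Y (user \<omega>)) W = 0 \<longleftrightarrow>
      (\<forall>x y w. pmf (map_pmf (\<lambda>u. (X u, Y u)) ?U) (x, y) * pmf ?\<mu> w * pmf ?\<mu> w =
        (pmf (map_pmf X ?U) x * pmf ?\<mu> w) * (pmf (map_pmf Y ?U) y * pmf ?\<mu> w))"
    by (simp add: CondMutInf_eq_0_iff[OF finite_set_pmf_joint_law[OF fin]] XYW Wp pmf_map_joint_law)
  also have "\<dots> \<longleftrightarrow> (\<forall>x y. pmf (map_pmf (\<lambda>u. (X u, Y u)) ?U) (x, y) =
      pmf (map_pmf X ?U) x * pmf (map_pmf Y ?U) y)"
    using w0 by (auto dest: spec[of _ w0])
  also have "\<dots> \<longleftrightarrow> ?R"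
    by (auto simp: pmf_eq_iff pmf_pair)
  finally show ?thesis .
qed

lemma
  demand_user: "demand = (\<lambda>\<omega>. fst (user \<omega>))" and
  Q1_user: "Q1 = (\<lambda>\<omega>. fst (snd (user \<omega>)))" and
  Q2_user: "Q2 = (\<lambda>\<omega>. snd (snd (user \<omega>)))"
  by (auto simp: user_def)

text \<open>The grid size \<open>s\<close> stays free: about the square root of \<open>N\<close>
  gives the order of the bound, and \<open>s = 0\<close> gives nonnegativity of the cost.\<close>

lemma download_lower_bound:
  assumes N: "N \<ge> 1" and pir: "two_server_PIR N P" and udiq: "UDIQ N P"
    and uq: "uniform_queries N P" and s: "s * s \<le> N"
  shows "real s / 2 \<le> total_download_cost N P"
proof -
  define U where "U = user_law P (demand_law P)"
  define \<mu> where "\<mu> = files_law N P"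
  define p1 where "p1 = map_pmf (\<lambda>u. fst (snd u)) U"
  define p2 where "p2 = map_pmf (\<lambda>u. snd (snd u)) U"
  define B where "B = file_bits P"
  define m1 where "m1 = map_pmf (A1 P) (law N P)"
  define m2 where "m2 = map_pmf (A2 P) (law N P)"
  \<comment> \<open>The conditional probability of the demand given both queries: independence of
    the queries makes the denominator their joint probability. Off the support the quotient is
    0.\<close>
  define f where "f = (\<lambda>d a b. pmf U (d, a, b) / (pmf p1 a * pmf p2 b))"
  \<comment> \<open>Cross-entropy of the answer to the fixed query \<open>a\<close> relative to the
    law \<open>m1\<close> of the answer under random queries.\<close>
  define c where "c = (\<lambda>a. measure_pmf.expectation \<mu> (\<lambda>w. - log 2 (pmf m1 (answer1 P a w))))"
  define e where "e = (\<lambda>b. measure_pmf.expectation \<mu> (\<lambda>w. - log 2 (pmf m2 (answer2 P b w))))"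
  have B: "B > 0" and dem: "demand_law P = pmf_of_set {1..N}"
    using pir udiq by (auto simp: two_server_PIR_def well_formed_def B_def UDIQ_def)
  have set_dem: "set_pmf (demand_law P) = {1..N}" using N dem by simp
  have finq: "finite (set_pmf (query_law P k))" if "k \<in> {1..N}" for k
  proof (rule finite_subset)
    show "set_pmf (query_law P k) \<subseteq> queries1 P \<times> queries2 P"
      using pir that unfolding two_server_PIR_def well_formed_def by blast
    show "finite (queries1 P \<times> queries2 P)" using uq by (simp add: uniform_queries_def)
  qed
  have finU: "finite (set_pmf U)"
    unfolding U_def using set_dem finq by (intro finite_set_pmf_user_law) auto
  have finL: "finite (set_pmf (law N P))"
    using finU unfolding U_def by (rule finite_set_pmf_joint_law)
  have fin1: "finite (set_pmf p1)" and fin2: "finite (set_pmf p2)"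
    using finU by (simp_all add: p1_def p2_def)
  have indep_queries: "map_pmf snd U = pair_pmf p1 p2"
    using udiq CondMutInf_user_eq_0_iff[OF finU[unfolded U_def], of N "\<lambda>u. fst (snd u)" "\<lambda>u. snd (snd u)"]
    by (auto simp: UDIQ_def Q1_user Q2_user p1_def p2_def U_def)
  have indep1: "map_pmf (\<lambda>u. (fst u, fst (snd u))) U = pair_pmf (pmf_of_set {1..N}) p1"
    and indep2: "map_pmf (\<lambda>u. (fst u, snd (snd u))) U = pair_pmf (pmf_of_set {1..N}) p2"
    using pir dem CondMutInf_user_eq_0_iff[OF finU[unfolded U_def], of N fst "\<lambda>u. fst (snd u)"]
      CondMutInf_user_eq_0_iff[OF finU[unfolded U_def], of N fst "\<lambda>u. snd (snd u)"]
    by (simp_all add: two_server_PIR_def user_private_def demand_user Q1_user Q2_user p1_def p2_def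
        U_def map_fst_user_law)

  have f_total: "(\<Sum>d\<in>{1..N}. f d a b) = 1" if "a \<in> set_pmf p1" "b \<in> set_pmf p2" for a b
  proof -
    have "(\<Sum>d\<in>{1..N}. pmf (map_pmf (\<lambda>u. (fst u, snd u)) U) (d, (a, b))) = pmf (map_pmf snd U) (a, b)"
    proof (rule sum_pmf_pair_fst)
      show "fst ` set_pmf U \<subseteq> {1..N}"
        unfolding U_def set_pmf_user_law set_dem by auto
    qed simp
    then have "(\<Sum>d\<in>{1..N}. pmf U (d, a, b)) = pmf p1 a * pmf p2 b"
      by (simp add: indep_queries pmf_pair)
    moreover have "pmf p1 a > 0" "pmf p2 b > 0" using that by (auto simp: pmf_positive)
    ultimately show ?thesis by (simp add: f_def sum_divide_distrib[symmetric])
  qed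
  \<comment> \<open>Averaging over the first query, which is independent of the second, gives the
    law of the demand given the second query alone; privacy at server 2 makes it uniform.\<close>
  have f_uniform1: "measure_pmf.expectation p1 (\<lambda>a. f d a b) = 1 / card {1..N}"
    if d: "d \<in> {1..N}" and b: "b \<in> set_pmf p2" for d b
  proof -
    have inj: "inj (\<lambda>(d, a, b). (a, d, b))" by (auto simp: inj_on_def)
    have b0: "pmf p2 b > 0" using b by (simp add: pmf_positive)
    have "measure_pmf.expectation p1 (\<lambda>a. f d a b) = (\<Sum>a\<in>set_pmf p1. f d a b * pmf p1 a)"
      using fin1 by (intro integral_measure_pmf_real) auto
    also have "\<dots> = (\<Sum>a\<in>set_pmf p1. pmf U (d, a, b)) / pmf p2 b"
      unfolding sum_divide_distrib by (intro sum.cong refl) (simp add: f_def set_pmf_iff)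
    also have "(\<Sum>a\<in>set_pmf p1. pmf U (d, a, b)) =
        (\<Sum>a\<in>set_pmf p1. pmf (map_pmf (\<lambda>u. (fst (snd u), fst u, snd (snd u))) U) (a, d, b))"
      using pmf_map_inj'[OF inj, of U "(d, _, b)"] by (simp add: case_prod_unfold)
    also have "\<dots> = pmf (map_pmf (\<lambda>u. (fst u, snd (snd u))) U) (d, b)"
      using fin1 by (intro sum_pmf_pair_fst) (auto simp: p1_def)
    also have "\<dots> = 1 / card {1..N} * pmf p2 b"
      using d by (simp add: indep2 pmf_pair)
    finally show ?thesis using b0 by simp
  qed
  have f_uniform2: "measure_pmf.expectation p2 (\<lambda>b. f d a b) = 1 / card {1..N}"
    if d: "d \<in> {1..N}" and a: "a \<in> set_pmf p1" for d a
  proof -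
    have inj: "inj (\<lambda>(d, a, b). (b, d, a))" by (auto simp: inj_on_def)
    have a0: "pmf p1 a > 0" using a by (simp add: pmf_positive)
    have "measure_pmf.expectation p2 (\<lambda>b. f d a b) = (\<Sum>b\<in>set_pmf p2. f d a b * pmf p2 b)"
      using fin2 by (intro integral_measure_pmf_real) auto
    also have "\<dots> = (\<Sum>b\<in>set_pmf p2. pmf U (d, a, b)) / pmf p1 a"
      unfolding sum_divide_distrib by (intro sum.cong refl) (simp add: f_def set_pmf_iff)
    also have "(\<Sum>b\<in>set_pmf p2. pmf U (d, a, b)) =
        (\<Sum>b\<in>set_pmf p2. pmf (map_pmf (\<lambda>u. (snd (snd u), fst u, fst (snd u))) U) (b, d, a))"
      using pmf_map_inj'[OF inj, of U "(d, a, _)"] by (simp add: case_prod_unfold)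
    also have "\<dots> = pmf (map_pmf (\<lambda>u. (fst u, fst (snd u))) U) (d, a)"
      using fin2 by (intro sum_pmf_pair_fst) (auto simp: p2_def)
    also have "\<dots> = 1 / card {1..N} * pmf p1 a"
      using d by (simp add: indep1 pmf_pair)
    finally show ?thesis using a0 by simp
  qed

  have fin\<mu>: "finite (set_pmf \<mu>)" by (simp add: \<mu>_def set_pmf_files_law finite_file_space)
  have expect: "measure_pmf.expectation (law N P) (\<lambda>\<omega>. g (W \<omega>) (user \<omega>)) =
      measure_pmf.expectation U (\<lambda>u. measure_pmf.expectation \<mu> (\<lambda>w. g w u))" for g :: "_ \<Rightarrow> _ \<Rightarrow> real"
  proof -
    have "measure_pmf.expectation (law N P) (\<lambda>\<omega>. g (W \<omega>) (user \<omega>)) =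
        measure_pmf.expectation (map_pmf (\<lambda>\<omega>. g (W \<omega>) (user \<omega>)) (law N P)) (\<lambda>x. x)"
      by simp
    also have "\<dots> = measure_pmf.expectation (pair_pmf \<mu> U) (\<lambda>(w, u). g w u)"
      unfolding map_pmf_joint_law by (simp add: \<mu>_def U_def)
    finally show ?thesis by (simp add: expectation_pair_pmf(2)[OF fin\<mu> finU])
  qed
  \<comment> \<open>The average of the cross-entropies over the query is the answer entropy itself,
    so nothing is lost here.\<close>
  have Ent1: "measure_pmf.expectation p1 c = Ent (law N P) (A1 P)"
    unfolding Ent_eq[OF finL] using expect[of "\<lambda>w u. - log 2 (pmf m1 (answer1 P (fst (snd u)) w))"]
    by (simp add: p1_def c_def m1_def A1_def user_def)
  have Ent2: "measure_pmf.expectation p2 e = Ent (law N P) (A2 P)"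
    unfolding Ent_eq[OF finL] using expect[of "\<lambda>w u. - log 2 (pmf m2 (answer2 P (snd (snd u)) w))"]
    by (simp add: p2_def e_def m2_def A2_def user_def)

  \<comment> \<open>Files are independent of queries, so every file family occurs with every
    possible query, and its answer has positive marginal probability.\<close>
  have pos1: "pmf m1 (answer1 P a w) > 0" if a: "a \<in> set_pmf p1" and w: "w \<in> file_space N B" for a w
  proof -
    obtain k b where "(k, a, b) \<in> set_pmf U" using a by (auto simp: p1_def)
    then have "\<lparr>W = w, demand = k, Q1 = a, Q2 = b\<rparr> \<in> set_pmf (law N P)"
      using w by (simp add: set_pmf_joint_law user_def U_def B_def)
    from pmf_map_pos[OF this, of "A1 P"] show ?thesis by (simp add: m1_def A1_def)
  qed
  have pos2: "pmf m2 (answer2 P b w) > 0" if b: "b \<in> set_pmf p2" and w: "w \<in> file_space N B" for b w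
  proof -
    obtain k a where "(k, a, b) \<in> set_pmf U" using b by (auto simp: p2_def)
    then have "\<lparr>W = w, demand = k, Q1 = a, Q2 = b\<rparr> \<in> set_pmf (law N P)"
      using w by (simp add: set_pmf_joint_law user_def U_def B_def)
    from pmf_map_pos[OF this, of "A2 P"] show ?thesis by (simp add: m2_def A2_def)
  qed
  \<comment> \<open>If demand \<open>d\<close> is possible at the pair \<open>(a, b)\<close>, then
    that pair also occurs when the demand is fixed to \<open>d\<close>, so the decodability
    condition for \<open>d\<close> applies to it.\<close>
  have decode: "w d = w' d"
    if U: "(d, a, b) \<in> set_pmf U" and w: "w \<in> file_space N B" "w' \<in> file_space N B"
      and eq: "answer1 P a w = answer1 P a w'" "answer2 P b w = answer2 P b w'" for d a b w w'
  proof -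
    have d: "d \<in> {1..N}" and ab: "(a, b) \<in> set_pmf (query_law P d)"
      using U set_dem by (auto simp: U_def set_pmf_user_law)
    let ?p = "joint_law N P (return_pmf d)"
    have fin: "finite (set_pmf ?p)"
      using finq d by (intro finite_set_pmf_joint_law finite_set_pmf_user_law) auto
    have "CondEnt ?p (\<lambda>\<omega>. W \<omega> d) (\<lambda>\<omega>. (A1 P \<omega>, A2 P \<omega>, Q1 \<omega>, Q2 \<omega>)) = 0"
      using pir d by (auto simp: two_server_PIR_def decodable_def)
    note * = this[unfolded CondEnt_eq_0_iff[OF fin]]
    have mem: "\<lparr>W = v, demand = d, Q1 = a, Q2 = b\<rparr> \<in> set_pmf ?p" if "v \<in> file_space N B" for v
      using that ab by (simp add: set_pmf_joint_law user_def set_pmf_user_law B_def)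
    show ?thesis
      using *[rule_format, OF mem[OF w(1)] mem[OF w(2)]] eq by (simp add: A1_def A2_def)
  qed

  have "real B * (real s * real s / 2) \<le>
      real s * (measure_pmf.expectation p1 c + measure_pmf.expectation p2 e)"
  proof (rule grid_bound[OF fin1 fin2, where D = "{1..N}" and f = f])
    fix x y :: "nat \<Rightarrow> nat"
    assume x: "\<And>i. i < s \<Longrightarrow> x i \<in> set_pmf p1" and y: "\<And>j. j < s \<Longrightarrow> y j \<in> set_pmf p2"
    \<comment> \<open>The disjoint sum merges the answers of both servers into one family, each
      measured against the marginal law of its own server.\<close>
    define v where "v = (\<lambda>k w. case k of Inl i \<Rightarrow> answer1 P (x i) w | Inr j \<Rightarrow> answer2 P (y j) w)"
    define m where "m = (\<lambda>k :: nat + nat. case k of Inl i \<Rightarrow> m1 | Inr j \<Rightarrow> m2)"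
    let ?K = "{..<s} <+> {..<s}" and ?G = "{d \<in> {1..N}. \<exists>i<s. \<exists>j<s. f d (x i) (y j) > 0}"
    have "real B * real (card ?G) \<le> (\<Sum>k\<in>?K. measure_pmf.expectation (pmf_of_set (file_space N B))
        (\<lambda>w. - log 2 (pmf (m k) (v k w))))"
    proof (rule determined_files_le_cross_entropy)
      fix k w assume "k \<in> ?K" "w \<in> file_space N B"
      then show "pmf (m k) (v k w) > 0"
        using pos1 pos2 x y by (auto simp: m_def v_def)
    next
      fix w w' d
      assume w: "w \<in> file_space N B" "w' \<in> file_space N B" and d: "d \<in> ?G"
        and v: "\<And>k. k \<in> ?K \<Longrightarrow> v k w = v k w'"
      obtain i j where ij: "i < s" "j < s" "f d (x i) (y j) > 0" using d by blast
      then have "(d, x i, y j) \<in> set_pmf U" by (auto simp: f_def set_pmf_iff)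
      moreover have "answer1 P (x i) w = answer1 P (x i) w'"
        using v[of "Inl i"] ij by (simp add: v_def InlI)
      moreover have "answer2 P (y j) w = answer2 P (y j) w'"
        using v[of "Inr j"] ij by (simp add: v_def InrI)
      ultimately show "w d = w' d" using decode w by blast
    qed auto
    then show "real B * real (card ?G) \<le> (\<Sum>i<s. c (x i)) + (\<Sum>j<s. e (y j))"
      by (simp add: sum.Plus m_def v_def c_def e_def \<mu>_def B_def)
  qed (use N s f_total f_uniform1 f_uniform2 in \<open>auto simp: f_def\<close>)
  then have "real s * (real B * (real s / 2)) \<le>
      real s * (Ent (law N P) (A1 P) + Ent (law N P) (A2 P))"
    unfolding Ent1 Ent2 by (simp add: mult_ac)
  \<comment> \<open>Needed for \<open>s = 0\<close>, where the factor \<open>s\<close> cannot be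
    cancelled.\<close>
  moreover have "Ent (law N P) X \<ge> 0" for X :: "outcome \<Rightarrow> bool list"
    unfolding Ent_eq[OF finL] by (intro integral_nonneg_AE AE_pmfI) (simp add: pmf_le_1 pmf_map_pos)
  ultimately have "real B * (real s / 2) \<le> Ent (law N P) (A1 P) + Ent (law N P) (A2 P)"
    by (cases "s = 0") auto
  then show ?thesis
    using B by (simp add: total_download_cost_def download_cost1_def download_cost2_def B_def field_simps)
qed

section \<open>The Maddah-Ali--Niesen scheme\<close>

lemma distinct_subsets_of_size: "distinct (subsets_of_size N t)"
  unfolding subsets_of_size_def by (intro distinct_filter distinct_set_subseqs) simp

lemma set_subsets_of_size: "set (subsets_of_size N t) = {T. T \<subseteq> {1..N} \<and> card T = t}"
  using subseqs_powset[of "[1..<Suc N]"] by (auto simp: subsets_of_size_def atLeastLessThanSuc_atLeastAtMost)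

lemma length_subsets_of_size: "length (subsets_of_size N t) = N choose t"
  using distinct_card[OF distinct_subsets_of_size, of N t] n_subsets[of "{1..N}" t]
  by (simp add: set_subsets_of_size)

text \<open>\<open>subfile\<close> finds its block by a linear search; without repetitions the
  search stops at the index of the subset itself.\<close>

lemma length_takeWhile_neq_nth:
  assumes "distinct xs" "j < length xs"
  shows "length (takeWhile (\<lambda>y. y \<noteq> xs ! j) xs) = j"
  using assms
proof (induction xs arbitrary: j)
  case (Cons x xs)
  then show ?case by (cases j) auto
qed simp

lemma subfile_nth:
  assumes "j < N choose t"
  shows "subfile N t L w (subsets_of_size N t ! j) = take L (drop (j * L) w)"
  using assms by (simp add: subfile_def length_takeWhile_neq_nth distinct_subsets_of_size length_subsets_of_size)

lemma length_subfile:
  assumes T: "T \<subseteq> {1..N}" "card T = t" and w: "length w = L * (N choose t)"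
  shows "length (subfile N t L w T) = L"
proof -
  have "T \<in> set (subsets_of_size N t)" using T by (simp add: set_subsets_of_size)
  then obtain j where j: "j < N choose t" "T = subsets_of_size N t ! j"
    by (auto simp: in_set_conv_nth length_subsets_of_size)
  have "(j + 1) * L \<le> (N choose t) * L" using j(1) by (intro mult_le_mono1) simp
  then show ?thesis using j w by (simp add: subfile_nth mult.commute)
qed

text \<open>The blocks tile the file: bit \<open>i\<close> lies in block \<open>i div L\<close> at
  offset \<open>i mod L\<close>.\<close>

lemma eq_by_subfiles:
  assumes w: "length w = L * (N choose t)" "length w' = L * (N choose t)"
    and eq: "\<And>T. T \<subseteq> {1..N} \<Longrightarrow> card T = t \<Longrightarrow> subfile N t L w T = subfile N t L w' T"
  shows "w = w'"
proof (rule nth_equalityI)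
  show "length w = length w'" using w by simp
  fix i assume "i < length w"
  then have i: "i < (N choose t) * L" using w by (simp add: mult.commute)
  then have L: "L > 0" by (cases L) auto
  define j where "j = i div L"
  have j: "j < N choose t" using i L by (simp add: j_def less_mult_imp_div_less)
  have ij: "i = j * L + i mod L" and m: "i mod L < L" using L by (simp_all add: j_def)
  have "subsets_of_size N t ! j \<in> set (subsets_of_size N t)"
    using j by (intro nth_mem) (simp add: length_subsets_of_size)
  then have "take L (drop (j * L) w) = take L (drop (j * L) w')"
    using eq j by (simp add: set_subsets_of_size flip: subfile_nth)
  then have "take L (drop (j * L) w) ! (i mod L) = take L (drop (j * L) w') ! (i mod L)" by simp
  moreover have nth: "take L (drop (j * L) u) ! (i mod L) = u ! i" if "length u = length w" for u
  proof -
    have "j * L + i mod L \<le> length u" using ij i w that by (simp add: mult.commute)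
    then show ?thesis using m ij by simp
  qed
  ultimately show "w ! i = w' ! i" using nth[of w] nth[of w'] w by argo
qed

text \<open>Answers carry no labels; since corresponding pieces have equal lengths, the
  concatenation can still be cut back into them.\<close>

lemma concat_map_eqD:
  assumes "concat (map g ks) = concat (map h ks)" "k \<in> set ks"
    and "\<And>k. k \<in> set ks \<Longrightarrow> length (g k) = length (h k)"
  shows "g k = h k"
proof -
  have "map g ks = map h ks"
    using assms by (intro concat_injective) (auto simp: zip_map_map zip_same_conv_map)
  then show ?thesis using assms(2) by simp
qed

section \<open>Cancellation in exclusive-ors and decoding of the coded transmissions\<close>

lemma map2_neq_cancel_left:
  fixes a x y :: "bool list"
  assumes "map2 (\<noteq>) a x = map2 (\<noteq>) a y" "length x = length a" "length y = length a"
  shows "x = y"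
proof (rule nth_equalityI)
  fix i assume "i < length x"
  then show "x ! i = y ! i"
    using arg_cong[OF assms(1), of "\<lambda>zs. zs ! i"] assms(2,3) by auto
qed (use assms in simp)

lemma map2_neq_cancel_right:
  fixes a x y :: "bool list"
  assumes "map2 (\<noteq>) x a = map2 (\<noteq>) y a" "length x = length a" "length y = length a"
  shows "x = y"
proof (rule nth_equalityI)
  fix i assume "i < length x"
  then show "x ! i = y ! i"
    using arg_cong[OF assms(1), of "\<lambda>zs. zs ! i"] assms(2,3) by auto
qed (use assms in simp)

lemma length_xor_list:
  assumes "\<And>x. x \<in> set xs \<Longrightarrow> length x = L"
  shows "length (xor_list L xs) = L"
  using assms by (induction xs) (auto simp: xor_list_def)

text \<open>The terms before \<open>r\<close> are known and cancel from the left one by one; once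
  \<open>r\<close> is reached, the remaining tails agree and cancel from the right.\<close>

lemma xor_list_cancel:
  assumes "distinct ks" "r \<in> set ks"
    and "\<And>k. k \<in> set ks \<Longrightarrow> length (f k) = L" "\<And>k. k \<in> set ks \<Longrightarrow> length (g k) = L"
    and "\<And>k. k \<in> set ks \<Longrightarrow> k \<noteq> r \<Longrightarrow> f k = g k"
    and "xor_list L (map f ks) = xor_list L (map g ks)"
  shows "f r = g r"
  using assms
proof (induction ks)
  case (Cons k ks)
  have len: "length (xor_list L (map f ks)) = L" "length (xor_list L (map g ks)) = L"
    using Cons.prems(3,4) by (auto intro!: length_xor_list)
  have eq: "map2 (\<noteq>) (f k) (xor_list L (map f ks)) = map2 (\<noteq>) (g k) (xor_list L (map g ks))"
    using Cons.prems(6) by (simp add: xor_list_def)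
  have lk: "length (f k) = L" "length (g k) = L" using Cons.prems(3,4) by auto
  show ?case
  proof (cases "k = r")
    case True
    then have "map f ks = map g ks" using Cons.prems(1,5) by auto
    then have "f k = g k"
      using map2_neq_cancel_right[OF eq[unfolded \<open>map f ks = map g ks\<close>]] len lk by simp
    then show ?thesis using True by simp
  next
    case False
    then have "f k = g k" using Cons.prems(5) by simp
    then have "xor_list L (map f ks) = xor_list L (map g ks)"
      using map2_neq_cancel_left[of "g k"] eq len lk by simp
    then show ?thesis using Cons False by auto
  qed
qed simp

text \<open>A single map over a list of indices, the form in which \<open>concat_map_eqD\<close>
  applies.\<close>

lemma man_cache_eq:
  "man_cache N t L i w = concat (map (\<lambda>(n, T). subfile N t L (w n) T)
     (List.product [1..<Suc N] (filter (\<lambda>T. i \<in> T) (subsets_of_size N t))))"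
proof -
  have "concat (map (\<lambda>T. if i \<in> T then [subfile N t L (w n) T] else []) xs) =
      map (subfile N t L (w n)) (filter (\<lambda>T. i \<in> T) xs)" for n xs
    by (induction xs) auto
  then show ?thesis
    by (simp add: man_cache_def product_concat_map map_concat comp_def del: upt_Suc)
qed

lemma man_delivery_eq:
  "man_delivery N t L dem w = concat (map (\<lambda>S. xor_list L
     (map (\<lambda>i. subfile N t L (w (dem i)) (S - {i})) (filter (\<lambda>i. i \<in> S) [1..<Suc N])))
     (subsets_of_size N (Suc t)))"
proof -
  have "concat (map (\<lambda>i. if i \<in> S then [g i] else []) xs) = map g (filter (\<lambda>i. i \<in> S) xs)"
    for g :: "nat \<Rightarrow> bool list" and S xs
    by (induction xs) auto
  then show ?thesis by (simp add: man_delivery_def del: upt_Suc)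
qed

lemma file_length: "w \<in> file_space N B \<Longrightarrow> n \<in> {1..N} \<Longrightarrow> length (w n) = B"
  by (auto simp: file_space_def)

lemma man_cache_eqD:
  assumes eq: "man_cache N t L r w = man_cache N t L r w'"
    and w: "w \<in> file_space N (L * (N choose t))" "w' \<in> file_space N (L * (N choose t))"
    and n: "n \<in> {1..N}" and T: "T \<subseteq> {1..N}" "card T = t" "r \<in> T"
  shows "subfile N t L (w n) T = subfile N t L (w' n) T"
  using concat_map_eqD[OF eq[unfolded man_cache_eq], of "(n, T)"] n T
  by (force simp: set_subsets_of_size length_subfile file_length[OF w(1)] file_length[OF w(2)])

lemma delivery_term_length:
  assumes dem: "\<And>i. i \<in> {1..N} \<Longrightarrow> dem i \<in> {1..N}" and w: "w \<in> file_space N (L * (N choose t))"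
    and S: "S \<subseteq> {1..N}" "card S = Suc t" "i \<in> S"
  shows "length (subfile N t L (w (dem i)) (S - {i})) = L"
proof (rule length_subfile)
  show "card (S - {i}) = t" using S finite_subset[OF S(1)] by simp
  show "length (w (dem i)) = L * (N choose t)" using dem S by (intro file_length[OF w]) auto
qed (use S in auto)

lemma man_delivery_eqD:
  assumes eq: "man_delivery N t L dem w = man_delivery N t L dem w'"
    and dem: "\<And>i. i \<in> {1..N} \<Longrightarrow> dem i \<in> {1..N}"
    and w: "w \<in> file_space N (L * (N choose t))" "w' \<in> file_space N (L * (N choose t))"
    and S: "S \<subseteq> {1..N}" "card S = Suc t"
  shows "xor_list L (map (\<lambda>i. subfile N t L (w (dem i)) (S - {i})) (filter (\<lambda>i. i \<in> S) [1..<Suc N])) =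
    xor_list L (map (\<lambda>i. subfile N t L (w' (dem i)) (S - {i})) (filter (\<lambda>i. i \<in> S) [1..<Suc N]))"
proof (rule concat_map_eqD[OF eq[unfolded man_delivery_eq]])
  show "S \<in> set (subsets_of_size N (Suc t))" using S by (simp add: set_subsets_of_size)
  fix S assume "S \<in> set (subsets_of_size N (Suc t))"
  then have S: "S \<subseteq> {1..N}" "card S = Suc t" by (simp_all add: set_subsets_of_size)
  have "length (xor_list L (map (\<lambda>i. subfile N t L (u (dem i)) (S - {i})) (filter (\<lambda>i. i \<in> S) [1..<Suc N]))) = L"
    if "u \<in> file_space N (L * (N choose t))" for u
    using delivery_term_length[OF dem that S] by (intro length_xor_list) auto
  then show "length (xor_list L (map (\<lambda>i. subfile N t L (w (dem i)) (S - {i})) (filter (\<lambda>i. i \<in> S) [1..<Suc N]))) =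
    length (xor_list L (map (\<lambda>i. subfile N t L (w' (dem i)) (S - {i})) (filter (\<lambda>i. i \<in> S) [1..<Suc N])))"
    using w by simp
qed

text \<open>A subfile indexed by \<open>T\<close> is cached if \<open>r \<in> T\<close>. Otherwise
  it is one term of the transmission for \<open>insert r T\<close>, and the index sets of all other
  terms contain \<open>r\<close>, so those terms are cached. Decoding is phrased as injectivity to
  match the criterion for vanishing conditional entropy.\<close>

lemma man_decode:
  assumes cache: "man_cache N t L r w = man_cache N t L r w'"
    and delivery: "man_delivery N t L dem w = man_delivery N t L dem w'"
    and dem: "\<And>i. i \<in> {1..N} \<Longrightarrow> dem i \<in> {1..N}" and r: "r \<in> {1..N}"
    and w: "w \<in> file_space N (L * (N choose t))" "w' \<in> file_space N (L * (N choose t))"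
  shows "w (dem r) = w' (dem r)"
proof (rule eq_by_subfiles)
  show "length (w (dem r)) = L * (N choose t)" "length (w' (dem r)) = L * (N choose t)"
    using dem r w by (auto intro: file_length)
  fix T assume T: "T \<subseteq> {1..N}" "card T = t"
  show "subfile N t L (w (dem r)) T = subfile N t L (w' (dem r)) T"
  proof (cases "r \<in> T")
    case True
    then show ?thesis using man_cache_eqD[OF cache w] dem r T by blast
  next
    case False
    define S where "S = insert r T"
    have S: "S \<subseteq> {1..N}" "card S = Suc t" "S - {r} = T"
      using T r False finite_subset[OF T(1)] by (auto simp: S_def)
    have "subfile N t L (w (dem r)) (S - {r}) = subfile N t L (w' (dem r)) (S - {r})"
    proof (rule xor_list_cancel[where f = "\<lambda>i. subfile N t L (w (dem i)) (S - {i})"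
          and g = "\<lambda>i. subfile N t L (w' (dem i)) (S - {i})"])
      show "xor_list L (map (\<lambda>i. subfile N t L (w (dem i)) (S - {i})) (filter (\<lambda>i. i \<in> S) [1..<Suc N])) =
        xor_list L (map (\<lambda>i. subfile N t L (w' (dem i)) (S - {i})) (filter (\<lambda>i. i \<in> S) [1..<Suc N]))"
        using man_delivery_eqD[OF delivery dem w S(1,2)] .
      show "r \<in> set (filter (\<lambda>i. i \<in> S) [1..<Suc N])" using r by (auto simp: S_def)
      fix k assume "k \<in> set (filter (\<lambda>i. i \<in> S) [1..<Suc N])"
      then have k: "k \<in> S" "k \<in> {1..N}" using S by auto
      show "length (subfile N t L (w (dem k)) (S - {k})) = L"
        "length (subfile N t L (w' (dem k)) (S - {k})) = L"
        using delivery_term_length[OF dem w(1) S(1,2) k(1)] delivery_term_length[OF dem w(2) S(1,2) k(1)]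
        by simp_all
      assume kr: "k \<noteq> r"
      show "subfile N t L (w (dem k)) (S - {k}) = subfile N t L (w' (dem k)) (S - {k})"
      proof (rule man_cache_eqD[OF cache w])
        show "dem k \<in> {1..N}" using dem k by blast
        show "S - {k} \<subseteq> {1..N}" using S by blast
        show "card (S - {k}) = t" using S k finite_subset[OF S(1)] by simp
        show "r \<in> S - {k}" using kr by (simp add: S_def)
      qed
    qed simp
    then show ?thesis using S by simp
  qed
qed

text \<open>Removing \<open>r\<close> maps the \<open>t\<close>-subsets containing it onto the
  \<open>(t - 1)\<close>-subsets of the other \<open>N - 1\<close> indices. By the absorption
  identity, the resulting number of subfiles of all \<open>N\<close> files is
  \<open>t * (N choose t)\<close>, that is \<open>t\<close> file sizes.\<close>

lemma length_man_cache:
  assumes t: "1 \<le> t" and r: "r \<in> {1..N}" and w: "w \<in> file_space N (L * (N choose t))"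
  shows "length (man_cache N t L r w) = t * (L * (N choose t))"
proof -
  let ?Ts = "filter (\<lambda>T. r \<in> T) (subsets_of_size N t)"
  have "set ?Ts = insert r ` {T. T \<subseteq> {1..N} - {r} \<and> card T = t - 1}"
  proof (intro equalityI subsetI)
    fix T assume "T \<in> set ?Ts"
    then have T: "T \<subseteq> {1..N}" "card T = t" "r \<in> T" by (auto simp: set_subsets_of_size)
    then have "T = insert r (T - {r})" "card (T - {r}) = t - 1" "T - {r} \<subseteq> {1..N} - {r}"
      using finite_subset[OF T(1)] by auto
    then show "T \<in> insert r ` {T. T \<subseteq> {1..N} - {r} \<and> card T = t - 1}" by blast
  next
    fix T assume "T \<in> insert r ` {T. T \<subseteq> {1..N} - {r} \<and> card T = t - 1}"
    then obtain T' where T': "T = insert r T'" "T' \<subseteq> {1..N} - {r}" "card T' = t - 1" by blast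
    then have "card T = t" using t finite_subset[OF T'(2)] by (subst T'(1), subst card_insert_disjoint) auto
    then show "T \<in> set ?Ts" using T' r by (auto simp: set_subsets_of_size)
  qed
  moreover have "inj_on (insert r) {T. T \<subseteq> {1..N} - {r} \<and> card T = t - 1}"
    by (rule inj_onI) blast
  ultimately have "card (set ?Ts) = card {T. T \<subseteq> {1..N} - {r} \<and> card T = t - 1}"
    by (simp add: card_image)
  also have "\<dots> = (N - 1) choose (t - 1)"
    using r by (subst n_subsets) simp_all
  finally have len: "length ?Ts = (N - 1) choose (t - 1)"
    using distinct_card[of ?Ts] distinct_subsets_of_size by simp
  have "length (man_cache N t L r w) =
      sum_list (map (\<lambda>_. L) (List.product [1..<Suc N] ?Ts))"
    unfolding man_cache_eq length_concat map_map
  proof (intro arg_cong[where f = sum_list] map_cong refl)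
    fix k assume "k \<in> set (List.product [1..<Suc N] ?Ts)"
    then obtain n T where "k = (n, T)" "n \<in> {1..N}" "T \<subseteq> {1..N}" "card T = t"
      by (auto simp: set_subsets_of_size simp del: upt_Suc)
    then show "(length \<circ> (\<lambda>(n, T). subfile N t L (w n) T)) k = L"
      using length_subfile[of T N t "w n" L] file_length[OF w, of n] by simp
  qed
  also have "\<dots> = N * ((N - 1) choose (t - 1)) * L"
    by (simp add: sum_list_triv len)
  also have "N * ((N - 1) choose (t - 1)) = t * (N choose t)"
    using t times_binomial_minus1_eq[of t N] by simp
  finally show ?thesis by simp
qed

lemma length_man_delivery:
  assumes dem: "\<And>i. i \<in> {1..N} \<Longrightarrow> dem i \<in> {1..N}" and w: "w \<in> file_space N (L * (N choose t))"
  shows "length (man_delivery N t L dem w) = (N choose Suc t) * L"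
proof -
  have "length (man_delivery N t L dem w) = sum_list (map (\<lambda>_. L) (subsets_of_size N (Suc t)))"
    unfolding man_delivery_eq length_concat map_map
  proof (intro arg_cong[where f = sum_list] map_cong refl)
    fix S assume "S \<in> set (subsets_of_size N (Suc t))"
    then have S: "S \<subseteq> {1..N}" "card S = Suc t" by (simp_all add: set_subsets_of_size)
    show "(length \<circ> (\<lambda>S. xor_list L (map (\<lambda>i. subfile N t L (w (dem i)) (S - {i}))
        (filter (\<lambda>i. i \<in> S) [1..<Suc N])))) S = L"
      using delivery_term_length[OF dem w S] by (auto intro!: length_xor_list)
  qed
  then show ?thesis by (simp add: sum_list_triv length_subsets_of_size)
qed

section \<open>Residue arithmetic and the joint law of demand and queries\<close>

lemma residue_in: "N \<ge> 1 \<Longrightarrow> residue N x \<in> {1..N}"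
  using pos_mod_bound[of "int N" "x - 1"] pos_mod_sign[of "int N" "x - 1"]
  by (auto simp: residue_def nat_le_iff Suc_le_eq nat_less_iff)

lemma int_residue_mod:
  assumes "N \<ge> 1"
  shows "int (residue N x) mod int N = x mod int N"
proof -
  have "int (residue N x) = (x - 1) mod int N + 1"
    using assms by (simp add: residue_def)
  then show ?thesis by (simp add: mod_simps)
qed

lemma eq_by_mod:
  assumes "i \<in> {1..N}" "j \<in> {1..N}" "int i mod int N = int j mod int N"
  shows "i = j"
proof -
  have "(int i - 1) mod int N = (int j - 1) mod int N"
    using assms(3) by (metis mod_diff_left_eq)
  then show ?thesis using assms(1,2) by simp
qed

text \<open>Reflection at \<open>r\<close> is an involution modulo \<open>N\<close>. This shows both
  that the delivery serves cache \<open>r\<close> with the true demand and that the second query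
  runs through all residues as the demand does.\<close>

lemma residue_diff_residue:
  assumes "k \<in> {1..N}"
  shows "residue N (int r - int (residue N (int r - int k))) = k"
proof (rule eq_by_mod)
  have N: "N \<ge> 1" using assms by simp
  then show "residue N (int r - int (residue N (int r - int k))) \<in> {1..N}" by (rule residue_in)
  have "int (residue N (int r - int (residue N (int r - int k)))) mod int N =
      (int r - int (residue N (int r - int k))) mod int N"
    by (rule int_residue_mod[OF N])
  also have "\<dots> = (int r - (int r - int k)) mod int N"
    by (intro mod_diff_cong int_residue_mod[OF N] refl)
  finally show "int (residue N (int r - int (residue N (int r - int k)))) mod int N = int k mod int N"
    by simp
qed (rule assms)

lemma map_pmf_residue_demand:
  assumes N: "N \<ge> 1"
  shows "map_pmf (\<lambda>k. residue N (int r - int k)) (pmf_of_set {1..N}) = pmf_of_set {1..N}"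
proof (rule map_pmf_of_set_bij_betw)
  have "inj_on (\<lambda>k. residue N (int r - int k)) {1..N}"
    by (rule inj_on_inverseI[of _ "\<lambda>q. residue N (int r - int q)"]) (rule residue_diff_residue)
  moreover have "(\<lambda>k. residue N (int r - int k)) ` {1..N} \<subseteq> {1..N}" using residue_in[OF N] by blast
  ultimately show "bij_betw (\<lambda>k. residue N (int r - int k)) {1..N} {1..N}"
    unfolding bij_betw_def using endo_inj_surj[of "{1..N}"] by blast
qed (use N in auto)

lemma map_pmf_residue_query:
  assumes N: "N \<ge> 1"
  shows "map_pmf (\<lambda>r. residue N (int r - int k)) (pmf_of_set {1..N}) = pmf_of_set {1..N}"
proof (rule map_pmf_of_set_bij_betw)
  have "inj_on (\<lambda>r. residue N (int r - int k)) {1..N}"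
  proof (rule inj_onI)
    fix r r' assume r: "r \<in> {1..N}" "r' \<in> {1..N}"
      and eq: "residue N (int r - int k) = residue N (int r' - int k)"
    have "(int r - int k) mod int N = (int r' - int k) mod int N"
      using eq int_residue_mod[OF N] by metis
    then have "(int r - int k + int k) mod int N = (int r' - int k + int k) mod int N"
      by (metis mod_add_left_eq)
    then show "r = r'" using eq_by_mod[OF r] by simp
  qed
  moreover have "(\<lambda>r. residue N (int r - int k)) ` {1..N} \<subseteq> {1..N}" using residue_in[OF N] by blast
  ultimately show "bij_betw (\<lambda>r. residue N (int r - int k)) {1..N} {1..N}"
    unfolding bij_betw_def using endo_inj_surj[of "{1..N}"] by blast
qed (use N in auto)

lemma map_pmf_pair_marginals:
  assumes "map_pmf (\<lambda>u. (X u, Y u)) p = pair_pmf q r"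
  shows "map_pmf X p = q" "map_pmf Y p = r"
proof -
  have "map_pmf X p = map_pmf fst (map_pmf (\<lambda>u. (X u, Y u)) p)" by (simp add: map_pmf_comp)
  then show "map_pmf X p = q" by (simp add: assms map_fst_pair_pmf)
  have "map_pmf Y p = map_pmf snd (map_pmf (\<lambda>u. (X u, Y u)) p)" by (simp add: map_pmf_comp)
  then show "map_pmf Y p = r" by (simp add: assms map_snd_pair_pmf)
qed

lemma user_law_man_pir:
  "user_law (man_pir N t L) D =
     do { k \<leftarrow> D; r \<leftarrow> pmf_of_set {1..N}; return_pmf (k, r, residue N (int r - int k)) }"
  by (simp add: user_law_def man_pir_def map_pmf_def bind_assoc_pmf bind_return_pmf)

text \<open>With the random index acting as a one-time pad, any two of demand, first query and
  second query are independent and uniform. The three pairs give privacy at server 1, privacy at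
  server 2 and UDIQ.\<close>

lemma man_pir_user_pairs:
  fixes N t L :: nat
  assumes N: "N \<ge> 1"
  defines "U \<equiv> user_law (man_pir N t L) (pmf_of_set {1..N})" and "u \<equiv> pmf_of_set {1..N}"
  shows "map_pmf (\<lambda>v. (fst v, fst (snd v))) U = pair_pmf u u"
    and "map_pmf (\<lambda>v. (fst v, snd (snd v))) U = pair_pmf u u"
    and "map_pmf (\<lambda>v. (fst (snd v), snd (snd v))) U = pair_pmf u u"
proof -
  have U: "U = do { k \<leftarrow> u; r \<leftarrow> u; return_pmf (k, r, residue N (int r - int k)) }"
    by (simp add: U_def user_law_man_pir u_def)
  show "map_pmf (\<lambda>v. (fst v, fst (snd v))) U = pair_pmf u u"
    by (simp add: U map_bind_pmf pair_pmf_def)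
  have "map_pmf (\<lambda>v. (fst v, snd (snd v))) U =
      u \<bind> (\<lambda>k. map_pmf (\<lambda>r. residue N (int r - int k)) u \<bind> (\<lambda>q. return_pmf (k, q)))"
    by (simp add: U map_bind_pmf bind_map_pmf)
  then show "map_pmf (\<lambda>v. (fst v, snd (snd v))) U = pair_pmf u u"
    by (simp only: u_def map_pmf_residue_query[OF N] pair_pmf_def)
  have "map_pmf (\<lambda>v. (fst (snd v), snd (snd v))) U =
      u \<bind> (\<lambda>k. u \<bind> (\<lambda>r. return_pmf (r, residue N (int r - int k))))"
    by (simp add: U map_bind_pmf)
  \<comment> \<open>With the index drawn before the demand, the uniform demand makes the second
    query uniform for each fixed \<open>r\<close>.\<close>
  also have "\<dots> = u \<bind> (\<lambda>r. u \<bind> (\<lambda>k. return_pmf (r, residue N (int r - int k))))"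
    by (rule bind_commute_pmf)
  also have "\<dots> = u \<bind> (\<lambda>r. map_pmf (\<lambda>k. residue N (int r - int k)) u \<bind> (\<lambda>q. return_pmf (r, q)))"
    by (simp add: bind_map_pmf)
  also have "\<dots> = pair_pmf u u"
    by (simp only: u_def map_pmf_residue_demand[OF N] pair_pmf_def)
  finally show "map_pmf (\<lambda>v. (fst (snd v), snd (snd v))) U = pair_pmf u u" .
qed

lemma man_pir_sel:
  "file_bits (man_pir N t L) = L * (N choose t)"
  "demand_law (man_pir N t L) = pmf_of_set {1..N}"
  "queries1 (man_pir N t L) = {1..N}"
  "queries2 (man_pir N t L) = {1..N}"
  "query_law (man_pir N t L) k = map_pmf (\<lambda>r. (r, residue N (int r - int k))) (pmf_of_set {1..N})"
  "answer1 (man_pir N t L) r = man_cache N t L r"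
  "answer2 (man_pir N t L) q = man_delivery N t L (\<lambda>i. residue N (int i - int q))"
  by (simp_all add: man_pir_def)

section \<open>The scheme meets all requirements\<close>

lemma finite_man_pir_user_law:
  assumes "N \<ge> 1" "finite (set_pmf D)"
  shows "finite (set_pmf (user_law (man_pir N t L) D))"
  using assms by (intro finite_set_pmf_user_law) (simp_all add: man_pir_sel)

lemma set_man_pir_joint_law:
  assumes N: "N \<ge> 1" and \<omega>: "\<omega> \<in> set_pmf (joint_law N (man_pir N t L) D)"
  shows "W \<omega> \<in> file_space N (L * (N choose t))" "demand \<omega> \<in> set_pmf D" "Q1 \<omega> \<in> {1..N}"
    "Q2 \<omega> = residue N (int (Q1 \<omega>) - int (demand \<omega>))"
  using \<omega> N by (auto simp: set_pmf_joint_law set_pmf_user_law man_pir_sel user_def)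

lemma decodable_man_pir:
  assumes N: "N \<ge> 1"
  shows "decodable N (man_pir N t L)"
  unfolding decodable_def
proof
  fix k assume k: "k \<in> {1..N}"
  let ?P = "man_pir N t L"
  let ?p = "joint_law N ?P (return_pmf k)"
  have fin: "finite (set_pmf ?p)"
    using finite_man_pir_user_law[OF N] by (intro finite_set_pmf_joint_law) simp
  show "CondEnt ?p (\<lambda>\<omega>. W \<omega> k) (\<lambda>\<omega>. (A1 ?P \<omega>, A2 ?P \<omega>, Q1 \<omega>, Q2 \<omega>)) = 0"
    unfolding CondEnt_eq_0_iff[OF fin]
  proof (intro ballI impI)
    fix \<omega> \<omega>' assume \<omega>: "\<omega> \<in> set_pmf ?p" and \<omega>': "\<omega>' \<in> set_pmf ?p"
      and eq: "(A1 ?P \<omega>, A2 ?P \<omega>, Q1 \<omega>, Q2 \<omega>) = (A1 ?P \<omega>', A2 ?P \<omega>', Q1 \<omega>', Q2 \<omega>')"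
    let ?dem = "\<lambda>i. residue N (int i - int (Q2 \<omega>))"
    have "W \<omega> (?dem (Q1 \<omega>)) = W \<omega>' (?dem (Q1 \<omega>))"
    proof (rule man_decode[where dem = ?dem and r = "Q1 \<omega>" and w = "W \<omega>" and w' = "W \<omega>'"])
      show "man_cache N t L (Q1 \<omega>) (W \<omega>) = man_cache N t L (Q1 \<omega>) (W \<omega>')"
        "man_delivery N t L ?dem (W \<omega>) = man_delivery N t L ?dem (W \<omega>')"
        using eq by (auto simp: A1_def A2_def man_pir_sel)
    qed (use residue_in[OF N] set_man_pir_joint_law[OF N \<omega>] set_man_pir_joint_law[OF N \<omega>'] in auto)
    \<comment> \<open>The entry of the demand vector at the index sent to server 1 is the user's
      demand.\<close>
    moreover have "?dem (Q1 \<omega>) = k"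
      using set_man_pir_joint_law[OF N \<omega>] k residue_diff_residue by auto
    ultimately show "W \<omega> k = W \<omega>' k" by simp
  qed
qed

lemma man_pir_correct:
  assumes N: "N \<ge> 1" and L: "L \<ge> 1" and t: "t \<le> N"
  shows "two_server_PIR N (man_pir N t L)" "UDIQ N (man_pir N t L)" "uniform_queries N (man_pir N t L)"
proof -
  let ?P = "man_pir N t L" and ?u = "pmf_of_set {1..N}"
  have fin: "finite (set_pmf (user_law ?P ?u))"
    using N by (intro finite_man_pir_user_law) simp_all
  note pairs = man_pir_user_pairs[OF N, of t L]
  note marg = map_pmf_pair_marginals[OF pairs(1)] map_pmf_pair_marginals[OF pairs(2)]
  have "CondMutInf (joint_law N ?P ?u) demand Q1 W = 0" "CondMutInf (joint_law N ?P ?u) demand Q2 W = 0"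
    "CondMutInf (joint_law N ?P ?u) Q1 Q2 W = 0"
    using CondMutInf_user_eq_0_iff[OF fin, of N fst "\<lambda>u. fst (snd u)"]
      CondMutInf_user_eq_0_iff[OF fin, of N fst "\<lambda>u. snd (snd u)"]
      CondMutInf_user_eq_0_iff[OF fin, of N "\<lambda>u. fst (snd u)" "\<lambda>u. snd (snd u)"]
    by (simp_all only: demand_user Q1_user Q2_user pairs marg)
  \<comment> \<open>The bounds on \<open>L\<close> and \<open>t\<close> make the file size
    positive.\<close>
  moreover have "well_formed N ?P"
    using N L t residue_in[OF N] by (auto simp: well_formed_def man_pir_sel)
  ultimately show "two_server_PIR N ?P" "UDIQ N ?P"
    using decodable_man_pir[OF N] by (simp_all add: two_server_PIR_def user_private_def UDIQ_def man_pir_sel)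
  have "map_pmf Q1 (law N ?P) = map_pmf (\<lambda>u. fst (snd u)) (map_pmf snd (pair_pmf (files_law N ?P) (user_law ?P ?u)))"
    using map_pmf_joint_law[of "\<lambda>w u. fst (snd u)" N ?P ?u]
    by (simp add: Q1_user man_pir_sel map_pmf_comp case_prod_unfold)
  then have law1: "map_pmf Q1 (law N ?P) = ?u"
    by (simp only: map_snd_pair_pmf marg)
  have "map_pmf Q2 (law N ?P) = map_pmf (\<lambda>u. snd (snd u)) (map_pmf snd (pair_pmf (files_law N ?P) (user_law ?P ?u)))"
    using map_pmf_joint_law[of "\<lambda>w u. snd (snd u)" N ?P ?u]
    by (simp add: Q2_user man_pir_sel map_pmf_comp case_prod_unfold)
  then have law2: "map_pmf Q2 (law N ?P) = ?u"
    by (simp only: map_snd_pair_pmf marg)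
  have "measure_pmf.prob (law N ?P) {\<omega>. Q1 \<omega> = q} = 1 / N" if "q \<in> {1..N}" for q
    using arg_cong[OF law1, of "\<lambda>p. pmf p q"] that N by (simp add: pmf_map vimage_def)
  moreover have "measure_pmf.prob (law N ?P) {\<omega>. Q2 \<omega> = q} = 1 / N" if "q \<in> {1..N}" for q
    using arg_cong[OF law2, of "\<lambda>p. pmf p q"] that N by (simp add: pmf_map vimage_def)
  ultimately show "uniform_queries N ?P"
    unfolding uniform_queries_def man_pir_sel(3,4) by simp
qed

section \<open>Upper bounds on the download cost\<close>

lemma Ent_bool_list_le:
  fixes X :: "'a \<Rightarrow> bool list"
  assumes "finite (set_pmf p)" "\<And>\<omega>. \<omega> \<in> set_pmf p \<Longrightarrow> length (X \<omega>) = l"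
  shows "Ent p X \<le> l"
proof -
  have "Ent p X \<le> log 2 (card {w :: bool list. length w = l})"
    using assms by (intro Ent_le_log_card) (auto simp: finite_bool_lists_length)
  then show ?thesis by (simp add: card_bool_lists_length log_nat_power)
qed

text \<open>Entropy is at most the bit length of an answer. An upper bound is all that order
  optimality asks of this scheme, so equality is not pursued.\<close>

lemma man_pir_cost_le:
  assumes N: "N \<ge> 1" and L: "L \<ge> 1" and t: "t \<in> {1..N}"
  shows "total_download_cost N (man_pir N t L) \<le> t + (real N - t) / (real t + 1)"
proof -
  let ?P = "man_pir N t L"
  let ?B = "L * (N choose t)"
  have fin: "finite (set_pmf (law N ?P))"
    using N by (intro finite_set_pmf_joint_law finite_man_pir_user_law) (simp_all add: man_pir_sel)
  have B: "real ?B > 0" using L t by simp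
  have "Ent (law N ?P) (A1 ?P) \<le> t * ?B"
    using t set_man_pir_joint_law[OF N]
    by (intro Ent_bool_list_le fin) (auto simp: A1_def man_pir_sel intro!: length_man_cache)
  then have 1: "download_cost1 N ?P \<le> t"
    using B by (simp add: download_cost1_def man_pir_sel pos_divide_le_eq)
  have "Ent (law N ?P) (A2 ?P) \<le> (N choose Suc t) * L"
    using set_man_pir_joint_law[OF N] residue_in[OF N]
    by (intro Ent_bool_list_le fin) (auto simp: A2_def man_pir_sel intro!: length_man_delivery)
  moreover have "real (N choose Suc t) * (real t + 1) = (real N - t) * (N choose t)"
  proof -
    have "Suc t * (N choose Suc t) = (N - t) * (N choose t)"
      by (simp add: binomial_absorption binomial_absorb_comp del: mult_Suc)
    then have "real (Suc t * (N choose Suc t)) = real ((N - t) * (N choose t))" by (rule arg_cong)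
    then show ?thesis using t by (simp add: of_nat_diff algebra_simps)
  qed
  then have "real (N choose Suc t) = (real N - t) * (N choose t) / (real t + 1)"
    by (intro eq_divide_imp) auto
  then have "real ((N choose Suc t) * L) = (real N - t) / (real t + 1) * ?B"
    by simp
  ultimately have "Ent (law N ?P) (A2 ?P) \<le> (real N - t) / (real t + 1) * ?B" by simp
  then have 2: "download_cost2 N ?P \<le> (real N - t) / (real t + 1)"
    using B unfolding download_cost2_def man_pir_sel by (simp only: pos_divide_le_eq)
  show ?thesis using 1 2 by (simp add: total_download_cost_def)
qed

lemma man_pir_cost_bound:
  fixes t :: "nat \<Rightarrow> nat"
  assumes t_range: "\<And>N. N \<ge> 1 \<Longrightarrow> t N \<in> {1..N}"
    and t_order: "(\<lambda>N. real (t N)) \<in> \<Theta>(\<lambda>N. sqrt (real N))"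
  obtains K where "K > 0"
    and "\<And>N L. N \<ge> 1 \<Longrightarrow> L \<ge> 1 \<Longrightarrow> total_download_cost N (man_pir N (t N) L) \<le> K * sqrt N"
proof -
  obtain c1 where c1: "c1 > 0" "eventually (\<lambda>N. norm (real (t N)) \<le> c1 * norm (sqrt (real N))) at_top"
    using t_order by (auto elim!: landau_o.bigE dest: bigthetaD1)
  obtain c2 where c2: "c2 > 0" "eventually (\<lambda>N. norm (real (t N)) \<ge> c2 * norm (sqrt (real N))) at_top"
    using t_order by (auto elim!: landau_omega.bigE dest: bigthetaD2)
  obtain N0 where N0: "\<And>N. N \<ge> N0 \<Longrightarrow> real (t N) \<le> c1 * sqrt N \<and> real (t N) \<ge> c2 * sqrt N"
    using eventually_conj[OF c1(2) c2(2)] by (auto simp: eventually_at_top_linorder)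
  \<comment> \<open>For \<open>N \<ge> N0\<close> the summand \<open>c1\<close> covers
    \<open>t N\<close> and \<open>1 / c2\<close> covers \<open>N / t N\<close>. For
    \<open>N < N0\<close> the crude bound \<open>2 * N\<close> is absorbed by the last summand, so
    that \<open>K\<close> serves every \<open>N \<ge> 1\<close>.\<close>
  define K where "K = c1 + 1 / c2 + 2 * N0"
  show thesis
  proof
    show "K > 0" using c1(1) c2(1) by (simp add: K_def add_pos_nonneg)
    fix N L :: nat assume N: "N \<ge> 1" and L: "L \<ge> 1"
    have sq: "sqrt N \<ge> 1" using N by simp
    have t: "1 \<le> t N" "t N \<le> N" using t_range[OF N] by auto
    have "total_download_cost N (man_pir N (t N) L) \<le> t N + (real N - t N) / (real (t N) + 1)"
      by (rule man_pir_cost_le[OF N L t_range[OF N]])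
    also have "(real N - t N) / (real (t N) + 1) \<le> N / t N"
      using t by (intro frac_le) auto
    finally have cost: "total_download_cost N (man_pir N (t N) L) \<le> t N + real N / t N" by simp
    show "total_download_cost N (man_pir N (t N) L) \<le> K * sqrt N"
    proof (cases "N \<ge> N0")
      case True
      have "real N / t N \<le> real N / (c2 * sqrt N)"
        using N0[OF True] c2(1) sq t by (intro divide_left_mono) auto
      also have "\<dots> = 1 / c2 * sqrt N"
        using sq c2(1) by (simp add: field_simps)
      finally have "real N / t N \<le> 1 / c2 * sqrt N" .
      then have "t N + real N / t N \<le> (c1 + 1 / c2) * sqrt N"
        using N0[OF True] by (simp add: distrib_right)
      also have "\<dots> \<le> K * sqrt N" using sq by (intro mult_right_mono) (simp_all add: K_def)
      finally show ?thesis using cost by simp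
    next
      case False
      have "real N / t N \<le> N" using t by (simp add: field_simps)
      then have "t N + real N / t N \<le> 2 * real N0 * 1" using t False by simp
      also have "\<dots> \<le> K * sqrt N"
        using sq c1(1) c2(1) by (intro mult_mono) (simp_all add: K_def)
      finally show ?thesis using cost by simp
    qed
  qed
qed

text \<open>The first conjunct places the scheme in the class over which it is optimal. Comparison
  with every \<open>P\<close> takes the place of a minimum, which then need not be attained. The
  file sizes of the two schemes are unrelated, costs being normalised, and \<open>C\<close> depends
  neither on \<open>N\<close> nor on \<open>L\<close>.\<close>

theorem corollary4:
  fixes t :: "nat \<Rightarrow> nat"
  assumes t_range: "\<And>N. N \<ge> 1 \<Longrightarrow> t N \<in> {1..N}"
    and t_order: "(\<lambda>N. real (t N)) \<in> \<Theta>(\<lambda>N. sqrt (real N))"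
  shows "(\<forall>N\<ge>1. \<forall>L\<ge>1.
            two_server_PIR N (man_pir N (t N) L) \<and> UDIQ N (man_pir N (t N) L) \<and>
            uniform_queries N (man_pir N (t N) L))
       \<and> (\<forall>L. (\<forall>N. L N \<ge> 1) \<longrightarrow>
            (\<lambda>N. total_download_cost N (man_pir N (t N) (L N))) \<in> O(\<lambda>N. sqrt (real N)))
       \<and> (\<exists>C>0. \<forall>N\<ge>1. \<forall>L\<ge>1. \<forall>P.
            two_server_PIR N P \<and> UDIQ N P \<and> uniform_queries N P \<longrightarrow>
            total_download_cost N (man_pir N (t N) L) \<le> C * total_download_cost N P)"
proof (intro conjI)
  have tN: "t N \<le> N" if "N \<ge> 1" for N using t_range[OF that] by simp
  show correct: "\<forall>N\<ge>1. \<forall>L\<ge>1. two_server_PIR N (man_pir N (t N) L) \<and> UDIQ N (man_pir N (t N) L) \<and>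
      uniform_queries N (man_pir N (t N) L)"
    using man_pir_correct[OF _ _ tN] by simp
  obtain K where K: "K > 0"
    and cost: "\<And>N L. N \<ge> 1 \<Longrightarrow> L \<ge> 1 \<Longrightarrow> total_download_cost N (man_pir N (t N) L) \<le> K * sqrt N"
    using man_pir_cost_bound[OF t_range t_order] by blast
  show "\<forall>L. (\<forall>N. L N \<ge> 1) \<longrightarrow>
      (\<lambda>N. total_download_cost N (man_pir N (t N) (L N))) \<in> O(\<lambda>N. sqrt (real N))"
  proof (intro allI impI bigoI)
    fix L :: "nat \<Rightarrow> nat" assume L: "\<forall>N. L N \<ge> 1"
    show "eventually (\<lambda>N. norm (total_download_cost N (man_pir N (t N) (L N))) \<le> K * norm (sqrt (real N))) at_top"
      using eventually_ge_at_top[of 1]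
    proof eventually_elim
      case (elim N)
      \<comment> \<open>Taking \<open>s = 0\<close> in the lower bound removes the norm.\<close>
      have "0 \<le> total_download_cost N (man_pir N (t N) (L N))"
        using download_lower_bound[OF elim, of _ 0] correct elim L by auto
      then show ?case using cost[OF elim, of "L N"] L by simp
    qed
  qed
  show "\<exists>C>0. \<forall>N\<ge>1. \<forall>L\<ge>1. \<forall>P.
      two_server_PIR N P \<and> UDIQ N P \<and> uniform_queries N P \<longrightarrow>
      total_download_cost N (man_pir N (t N) L) \<le> C * total_download_cost N P"
  \<comment> \<open>One factor 2 comes from the 1/2 in the lower bound, the other from rounding: for
    \<open>N \<ge> 1\<close> the integer part of the square root is at least half of it.\<close>
  proof (intro exI[of _ "4 * K"] conjI allI impI)
    show "4 * K > 0" using K by simp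
    fix N L :: nat and P assume N: "1 \<le> N" and L: "1 \<le> L"
      and P: "two_server_PIR N P \<and> UDIQ N P \<and> uniform_queries N P"
    define s where "s = nat \<lfloor>sqrt N\<rfloor>"
    have sq: "sqrt N \<ge> 1" using N by simp
    have s: "real s \<le> sqrt N" "sqrt N < real s + 1" using sq by (simp_all add: s_def)
    then have s1: "s \<ge> 1" using sq by linarith
    have "real (s * s) \<le> N"
      using mult_mono[OF s(1) s(1)] by simp
    then have "s * s \<le> N" by (simp only: of_nat_le_iff)
    then have "real s / 2 \<le> total_download_cost N P"
      using download_lower_bound[OF N] P by blast
    moreover have "sqrt N \<le> 2 * real s" using s(2) s1 by simp
    ultimately have "sqrt N \<le> 4 * total_download_cost N P" by simp
    then have "K * sqrt N \<le> 4 * K * total_download_cost N P"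
      using mult_left_mono[of "sqrt N" "4 * total_download_cost N P" K] K by (simp add: mult_ac)
    then show "total_download_cost N (man_pir N (t N) L) \<le> 4 * K * total_download_cost N P"
      using cost[OF N L] by simp
  qed
qed

end
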